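(* For each $n$ there is a finite collection $\mathcal{E}_n$ of families of lattice polytopes in $\mathbb{R}^n$ (depending only on $n$) such that the following holds. Let $P_1, \ldots, P_m$ be a proper family of lattice polytopes in $\mathbb{R}^n$ with $\operatorname{md}(P_1, \ldots, P_m) = 0$ and $m > n$. Then either (1) there is a unimodular $n$-simplex $Q$ such that every $P_i$ is contained in a lattice translate of $Q$, or (2) the family $P_1,\ldots,P_m$ is identified with a member of $\mathcal{E}_n$. Moreover, in case (1), at most $(2^n-1)(n-1)$ of the polytopes $P_1,\ldots,P_m$ are not lattice translates of $Q$; more precisely, for every face $F$ of $Q$ of dimension $j < n$, the number of indices $i$ such that $P_i$ is a lattice translate of $F$ is at most $j$.
   Context: A lattice polytope in $\mathbb{R}^n$ is a polytope with vertices in $\mathbb{Z}^n$; a unimodular $n$-simplex is the image of $\operatorname{conv}(0,e_1,\ldots,e_n)$ under an affine unimodular transformation of $\mathbb{Z}^n$. Two families are identified if they agree up to a simultaneous affine unimodular transformation of $\mathbb{Z}^n$, permutation of the members, and lattice translations of the individual members. For $\emptyset\neq I\subseteq[m]$, $P_I:=\sum_{i\in I}P_i$ (Minkowski sum). The family is proper if each $\dim P_i\ge1$ and $\dim(P_{[m]})=n$. $\operatorname{int}_{\mathbb{Z}}(A)$ is the set of lattice points in the relative interior of $A$ (the relative interior of a point is the point itself). The mixed codegree $\operatorname{mcd}(P_1,\ldots,P_m)$ is the minimal cardinality of a nonempty $I\subseteq[m]$ with $\operatorname{int}_{\mathbb{Z}}(P_I)\neq\emptyset$, or $m+1$ if none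 exists; the mixed degree is $\operatorname{md}(P_1,\ldots,P_m):=\dim(P_{[m]})+1-\operatorname{mcd}(P_1,\ldots,P_m)$. *)

theory Defs
  imports "HOL-Analysis.Analysis" "HOL-Library.Set_Algebras"
begin

definition int_lattice :: "(real ^ 'n::finite) set" where
  "int_lattice = {x. \<forall>i. x $ i \<in> \<int>}"

text \<open>The library's \<^const>\<open>polytope\<close> admits the empty set; lattice polytopes are nonempty here.\<close>

definition lattice_polytope :: "(real ^ 'n::finite) set \<Rightarrow> bool" where
  "lattice_polytope P \<longleftrightarrow> polytope P \<and> P \<noteq> {} \<and> {v. v extreme_point_of P} \<subseteq> int_lattice"

definition lattice_translate :: "(real ^ 'n::finite) set \<Rightarrow> (real ^ 'n) set \<Rightarrow> bool" where
  "lattice_translate A B \<longleftrightarrow> (\<exists>t\<in>int_lattice. A = (+) t ` B)"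

definition affine_unimodular :: "(real ^ 'n::finite \<Rightarrow> real ^ 'n) \<Rightarrow> bool" where
  "affine_unimodular \<phi> \<longleftrightarrow>
     (\<exists>(A :: real ^ 'n ^ 'n) b. (\<forall>i j. A $ i $ j \<in> \<int>) \<and> \<bar>det A\<bar> = 1 \<and> b \<in> int_lattice \<and>
        \<phi> = (\<lambda>x. A *v x + b))"

definition unimodular_simplex :: "(real ^ 'n::finite) set \<Rightarrow> bool" where
  "unimodular_simplex Q \<longleftrightarrow> (\<exists>\<phi>. affine_unimodular \<phi> \<and> Q = \<phi> ` (convex hull (insert 0 Basis)))"

definition int_points :: "(real ^ 'n::finite) set \<Rightarrow> (real ^ 'n) set" where
  "int_points A = rel_interior A \<inter> int_lattice"

text \<open>A family \<open>P\<^sub>1, \<dots>, P\<^sub>m\<close> is a list of sets, with indices shifted to \<open>{..<m}\<close>.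
  The sum of sets below is the Minkowski sum of \<^theory>\<open>HOL-Library.Set_Algebras\<close>.\<close>

definition subfamily_sum :: "(real ^ 'n::finite) set list \<Rightarrow> nat set \<Rightarrow> (real ^ 'n) set" where
  "subfamily_sum Ps I = (\<Sum>i\<in>I. Ps ! i)"

definition total_sum :: "(real ^ 'n::finite) set list \<Rightarrow> (real ^ 'n) set" where
  "total_sum Ps = subfamily_sum Ps {..<length Ps}"

definition proper_family :: "(real ^ 'n::finite) set list \<Rightarrow> bool" where
  "proper_family Ps \<longleftrightarrow>
     (\<forall>i<length Ps. aff_dim (Ps ! i) \<ge> 1) \<and> aff_dim (total_sum Ps) = int CARD('n)"

definition mixed_codegree :: "(real ^ 'n::finite) set list \<Rightarrow> nat" where
  "mixed_codegree Ps =
     (let \<I> = {I. I \<noteq> {} \<and> I \<subseteq> {..<length Ps} \<and> int_points (subfamily_sum Ps I) \<noteq> {}}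
      in if \<I> = {} then length Ps + 1 else Min (card ` \<I>))"

definition mixed_degree :: "(real ^ 'n::finite) set list \<Rightarrow> int" where
  "mixed_degree Ps = aff_dim (total_sum Ps) + 1 - int (mixed_codegree Ps)"

definition identified :: "(real ^ 'n::finite) set list \<Rightarrow> (real ^ 'n) set list \<Rightarrow> bool" where
  "identified Ps Rs \<longleftrightarrow> length Ps = length Rs \<and>
     (\<exists>\<phi> \<sigma>. affine_unimodular \<phi> \<and> \<sigma> permutes {..<length Ps} \<and>
        (\<forall>i<length Ps. lattice_translate (Rs ! \<sigma> i) (\<phi> ` (Ps ! i))))"

end

theory Submission
  imports Defs
begin

text \<open>
  Mixed degree zero with \<open>m > n\<close> says that no sum of at most \<open>n\<close> members has a relative interior
  lattice point. Choose lattice differences \<open>f\<^sub>i\<close> of \<open>n\<close> distinct members that form a basis of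
  \<open>\<real>\<^sup>n\<close>. If some lattice point had a fractional coordinate in this basis, the parallelepiped it
  generates would contain a lattice point, and adding suitable endpoints of the remaining segments
  moves this point into the relative interior of a sum of members. Hence the \<open>f\<^sub>i\<close> form a lattice
  basis. Exchanging one \<open>f\<^sub>i\<close> for a difference \<open>d\<close> of a member outside the basis shows that \<open>d\<close>
  has coordinates in \<open>{-1, 0, 1}\<close>; augmenting paths, as in the proof of Rado's theorem on
  transversals, make every member such an outsider. So all members fit, up to translation, in a box
  whose size depends only on \<open>n\<close>. This leaves finitely many families of bounded length. If the
  family is long, more than \<open>n\<close> members are translates of a single polytope \<open>F\<close>. At most \<open>j\<close>
  members can be translates of the same \<open>j\<close>-dimensional polytope when \<open>j < n\<close>, so \<open>F\<close> has dimension \<open>n\<close>; \<open>n + 1\<close> of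
  its lattice points then span a unimodular simplex, and barycentric coordinates relative to it show
  that a translate contains every member.
\<close>

section \<open>Lattice differences and relative interior points\<close>

text \<open>Differences do not see lattice translations, and for a lattice polytope they span its
  space of directions, so they carry the linear data of a member used below.\<close>

definition lattice_diffs :: "(real ^ 'n::finite) set \<Rightarrow> (real ^ 'n) set" where
  "lattice_diffs P = {p - q | p q. p \<in> P \<inter> int_lattice \<and> q \<in> P \<inter> int_lattice}"

lemma int_lattice_zero [simp]: "0 \<in> int_lattice"
  by (simp add: int_lattice_def)

lemma int_lattice_add: "x \<in> int_lattice \<Longrightarrow> y \<in> int_lattice \<Longrightarrow> x + y \<in> int_lattice"
  by (simp add: int_lattice_def)

lemma int_lattice_diff: "x \<in> int_lattice \<Longrightarrow> y \<in> int_lattice \<Longrightarrow> x - y \<in> int_lattice"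
  by (simp add: int_lattice_def)

lemma int_lattice_scaleR: "x \<in> int_lattice \<Longrightarrow> c \<in> \<int> \<Longrightarrow> c *\<^sub>R x \<in> int_lattice"
  by (simp add: int_lattice_def)

lemma int_lattice_sum: "(\<And>i. i \<in> I \<Longrightarrow> f i \<in> int_lattice) \<Longrightarrow> sum f I \<in> int_lattice"
  by (auto simp: int_lattice_def intro!: Ints_sum)

lemma lattice_diffs_int_lattice: "d \<in> lattice_diffs P \<Longrightarrow> d \<in> int_lattice"
  by (auto simp: lattice_diffs_def int_lattice_diff)

lemma lattice_diffs_uminus: "d \<in> lattice_diffs P \<Longrightarrow> - d \<in> lattice_diffs P"
  by (force simp: lattice_diffs_def)

lemma lattice_diffs_translation:
  fixes P :: "(real ^ 'n::finite) set"
  assumes "t \<in> int_lattice"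
  shows "lattice_diffs ((+) t ` P) = lattice_diffs P"
proof -
  have "t + x \<in> int_lattice \<longleftrightarrow> x \<in> int_lattice" for x
    using int_lattice_add[OF assms, of x] int_lattice_diff[OF _ assms, of "t + x"] by auto
  then have "((+) t ` P) \<inter> int_lattice = (+) t ` (P \<inter> int_lattice)"
    by auto
  moreover have "lattice_diffs A = (\<lambda>(p, q). p - q) ` ((A \<inter> int_lattice) \<times> (A \<inter> int_lattice))" for A :: "(real ^ 'n) set"
    by (auto simp: lattice_diffs_def)
  ultimately show ?thesis
    by (auto simp: image_iff) blast+
qed

section \<open>Lattice polytopes and their directions\<close>

lemma lattice_polytope_eq_hull:
  assumes "lattice_polytope P"
  shows "P = convex hull (P \<inter> int_lattice)"
proof -
  have "P = convex hull {v. v extreme_point_of P}"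
    using assms Krein_Milman_Minkowski polytope_imp_compact polytope_imp_convex
    unfolding lattice_polytope_def by blast
  moreover have "{v. v extreme_point_of P} \<subseteq> P \<inter> int_lattice"
    using assms by (auto simp: lattice_polytope_def extreme_point_of_def)
  moreover have "convex hull (P \<inter> int_lattice) \<subseteq> P"
    using assms by (simp add: hull_minimal lattice_polytope_def polytope_imp_convex)
  ultimately show ?thesis
    by (metis hull_mono subset_antisym)
qed

lemma lattice_polytope_imp_convex: "lattice_polytope P \<Longrightarrow> convex P"
  by (simp add: lattice_polytope_def polytope_imp_convex)

lemma lattice_polytope_obtain_point:
  assumes "lattice_polytope P"
  obtains x where "x \<in> P" "x \<in> int_lattice"
  using lattice_polytope_eq_hull[OF assms] assms
  by (metis IntD1 IntD2 convex_hull_eq_empty equals0I lattice_polytope_def)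

lemma diff_in_span_if_lattice_points:
  assumes "lattice_polytope P" "x \<in> P" "y \<in> P" 
    and sub: "\<And>v. v \<in> P \<inter> int_lattice \<Longrightarrow> v - x0 \<in> span D"
  shows "x - y \<in> span D"
proof -
  have "convex ((+) x0 ` span D)"
    by (simp add: convex_translation subspace_imp_convex)
  moreover have "P \<inter> int_lattice \<subseteq> (+) x0 ` span D"
    using sub by (force simp: image_iff algebra_simps)
  ultimately have "P \<subseteq> (+) x0 ` span D"
    by (metis assms(1) hull_minimal lattice_polytope_eq_hull)
  then obtain a b where "a \<in> span D" "b \<in> span D" "x = x0 + a" "y = x0 + b"
    using assms by blast
  then show ?thesis
    by (simp add: span_diff)
qed

lemma diff_in_span:
  assumes "lattice_polytope P" "x \<in> P" "y \<in> P" "lattice_diffs P \<subseteq> span D"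
  shows "x - y \<in> span D"
proof -
  obtain x0 where x0: "x0 \<in> P" "x0 \<in> int_lattice"
    using lattice_polytope_obtain_point assms(1) by blast
  have "v - x0 \<in> span D" if "v \<in> P \<inter> int_lattice" for v
    using that x0 assms(4) by (auto simp: lattice_diffs_def)
  then show ?thesis
    using assms diff_in_span_if_lattice_points by blast
qed

text \<open>A point of \<open>C\<close> outside the relative interior has a supporting hyperplane
  that misses the relative interior; its negated normal is maximal at \<open>z\<close> without being
  constant on \<open>C\<close>.\<close>

lemma mem_rel_interior_if_functionals:
  fixes C :: "'a::euclidean_space set"
  assumes "convex C" "z \<in> C"
    and const: "\<And>u. (\<And>p. p \<in> C \<Longrightarrow> u \<bullet> p \<le> u \<bullet> z) \<Longrightarrow> (\<And>p. p \<in> C \<Longrightarrow> u \<bullet> p = u \<bullet> z)"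
  shows "z \<in> rel_interior C"
proof (rule ccontr)
  assume "z \<notin> rel_interior C"
  then obtain a where a: "\<And>y. y \<in> C \<Longrightarrow> a \<bullet> z \<le> a \<bullet> y" "\<And>y. y \<in> rel_interior C \<Longrightarrow> a \<bullet> z < a \<bullet> y"
    using supporting_hyperplane_rel_boundary[OF assms(1,2)] by metis
  obtain y where y: "y \<in> rel_interior C"
    using assms(1,2) rel_interior_eq_empty by fastforce
  have "(- a) \<bullet> y = (- a) \<bullet> z"
    using a y const[of "- a" y] rel_interior_subset by fastforce
  then show False
    using a(2)[OF y] by simp
qed

section \<open>Coordinates with respect to indexed families of vectors\<close>

lemma in_span_image_finite:
  fixes f :: "'b \<Rightarrow> 'a::real_vector"
  assumes "finite S" "x \<in> span (f ` S)"
  obtains c where "x = (\<Sum>i\<in>S. c i *\<^sub>R f i)"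
proof -
  have "\<exists>c. x = (\<Sum>i\<in>S. c i *\<^sub>R f i)"
    using assms
  proof (induction S arbitrary: x)
    case (insert a S)
    then obtain k where "x - k *\<^sub>R f a \<in> span (f ` S)"
      by (auto simp: span_breakdown_eq)
    then obtain c where "x - k *\<^sub>R f a = (\<Sum>i\<in>S. c i *\<^sub>R f i)"
      using insert by blast
    moreover have "(\<Sum>i\<in>S. (c(a := k)) i *\<^sub>R f i) = (\<Sum>i\<in>S. c i *\<^sub>R f i)"
      using insert.hyps by (intro sum.cong) auto
    ultimately have "x = (\<Sum>i\<in>insert a S. (c(a := k)) i *\<^sub>R f i)"
      using insert.hyps by (simp add: algebra_simps)
    then show ?case by blast
  qed auto
  then show ?thesis using that by blast
qed

lemma sum_in_span_image: "(\<Sum>i\<in>S. c i *\<^sub>R f i) \<in> span (f ` S)"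
  by (intro span_sum span_scale span_base) auto

lemma independent_family_coeffs_eq:
  fixes f :: "'b \<Rightarrow> 'a::real_vector"
  assumes "finite S" "inj_on f S" "independent (f ` S)"
    and eq: "(\<Sum>i\<in>S. a i *\<^sub>R f i) = (\<Sum>i\<in>S. b i *\<^sub>R f i)" and "i \<in> S"
  shows "a i = b i"
proof -
  define g where "g = (\<lambda>v. (a (the_inv_into S f v) - b (the_inv_into S f v)))"
  have "(\<Sum>v\<in>f ` S. g v *\<^sub>R v) = (\<Sum>i\<in>S. (a i - b i) *\<^sub>R f i)"
    by (subst sum.reindex[OF assms(2)]) (auto simp: g_def the_inv_into_f_f[OF assms(2)] intro!: sum.cong)
  also have "\<dots> = 0"
    using eq by (simp add: scaleR_left_diff_distrib sum_subtractf)
  finally have "g (f i) = 0"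
    using independentD[OF assms(3), of "f ` S" g "f i"] assms by auto
  then show ?thesis
    using assms by (simp add: g_def the_inv_into_f_f)
qed

lemma spanning_family_independent:
  fixes f :: "'b \<Rightarrow> 'a::euclidean_space"
  assumes "finite S" "card S = DIM('a)" "span (f ` S) = UNIV"
  shows "inj_on f S" "independent (f ` S)"
proof -
  have "card (f ` S) \<le> DIM('a)"
    using assms card_image_le by metis
  then show ind: "independent (f ` S)"
    using card_le_dim_spanning[of "f ` S" UNIV] assms by auto
  have "card (f ` S) = DIM('a)"
    using ind assms(3) by (metis dim_UNIV dim_eq_card_independent dim_span)
  then show "inj_on f S"
    using assms by (simp add: eq_card_imp_inj_on)
qed

lemma independent_family_spanning:
  fixes f :: "'b \<Rightarrow> 'a::euclidean_space"
  assumes "finite S" "card S = DIM('a)" "inj_on f S" "independent (f ` S)"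
  shows "span (f ` S) = UNIV"
  using assms by (metis card_image dim_eq_card_independent dim_eq_full)

lemma orthogonal_to_span_image:
  assumes "\<And>i. i \<in> A \<Longrightarrow> u \<bullet> f i = 0" "x \<in> span (f ` A)"
  shows "u \<bullet> x = 0"
  using orthogonal_to_span[OF assms(2), of u] assms(1) by (auto simp: orthogonal_def)

section \<open>Minkowski sums and hollow families\<close>

lemma mem_subfamily_sum:
  assumes "finite I"
  shows "x \<in> subfamily_sum Ps I \<longleftrightarrow> (\<exists>g. (\<forall>i\<in>I. g i \<in> Ps ! i) \<and> x = sum g I)"
  using assms by (auto simp: subfamily_sum_def set_sum_alt)

lemma maximal_on_subfamily_sum:
  assumes "finite I" "\<And>i. i \<in> I \<Longrightarrow> g i \<in> Ps ! i"
    and "\<And>p. p \<in> subfamily_sum Ps I \<Longrightarrow> u \<bullet> p \<le> u \<bullet> sum g I" "i \<in> I" "y \<in> Ps ! i"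
  shows "u \<bullet> y \<le> u \<bullet> g i"
proof -
  have "sum (g(i := y)) I \<in> subfamily_sum Ps I"
    unfolding mem_subfamily_sum[OF assms(1)] using assms by (intro exI[of _ "g(i := y)"]) auto
  moreover have "sum (g(i := y)) I = sum g I - g i + y"
    using assms by (simp add: sum.remove sum.If_cases)
  ultimately show ?thesis
    using assms(3)[of "sum (g(i := y)) I"] by (simp add: inner_add_right inner_diff_right)
qed

text \<open>The total sum of a proper family has dimension \<open>CARD('n)\<close>, so mixed degree
  zero means mixed codegree \<open>CARD('n) + 1\<close>; \<open>hollow\<close> records that no
  smaller index set qualifies.\<close>

locale hollow_family =
  fixes Ps :: "(real ^ 'n::finite) set list"
  assumes lattice_polytope: "i < length Ps \<Longrightarrow> lattice_polytope (Ps ! i)"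
    and hollow: "I \<noteq> {} \<Longrightarrow> I \<subseteq> {..<length Ps} \<Longrightarrow> card I \<le> CARD('n) \<Longrightarrow>
      int_points (subfamily_sum Ps I) = {}"
begin

abbreviation D :: "nat \<Rightarrow> (real ^ 'n) set" where
  "D i \<equiv> lattice_diffs (Ps ! i)"

text \<open>A certificate form of hollowness: a functional maximal on a Minkowski sum at
  \<open>sum g I\<close> is maximal at each summand, so the relative interior can be tested member
  by member.\<close>

lemma hollowD:
  assumes "I \<noteq> {}" "I \<subseteq> {..<length Ps}" "card I \<le> CARD('n)"
    and g: "\<And>i. i \<in> I \<Longrightarrow> g i \<in> Ps ! i" "sum g I \<in> int_lattice"
    and const: "\<And>u i y. (\<And>i y. i \<in> I \<Longrightarrow> y \<in> Ps ! i \<Longrightarrow> u \<bullet> y \<le> u \<bullet> g i) \<Longrightarrow>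
      i \<in> I \<Longrightarrow> y \<in> Ps ! i \<Longrightarrow> u \<bullet> y = u \<bullet> g i"
  shows False
proof -
  have fin: "finite I"
    using assms(2) finite_subset by blast
  have "sum g I \<in> rel_interior (subfamily_sum Ps I)"
  proof (rule mem_rel_interior_if_functionals)
    show "convex (subfamily_sum Ps I)"
      unfolding subfamily_sum_def using assms(2) lattice_polytope lattice_polytope_imp_convex
      by (intro convex_set_sum) auto
    show "sum g I \<in> subfamily_sum Ps I"
      using g fin by (auto simp: mem_subfamily_sum)
    fix u p assume u: "\<And>p. p \<in> subfamily_sum Ps I \<Longrightarrow> u \<bullet> p \<le> u \<bullet> sum g I"
      and "p \<in> subfamily_sum Ps I"
    then obtain h where h: "\<forall>i\<in>I. h i \<in> Ps ! i" "p = sum h I"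
      using fin by (auto simp: mem_subfamily_sum)
    have "u \<bullet> y \<le> u \<bullet> g i" if "i \<in> I" "y \<in> Ps ! i" for i y
      using maximal_on_subfamily_sum[OF fin g(1) u that] by blast
    then have "u \<bullet> h i = u \<bullet> g i" if "i \<in> I" for i
      using const h that by blast
    then show "u \<bullet> p = u \<bullet> sum g I"
      using h by (simp add: inner_sum_right)
  qed
  then show False
    using hollow[OF assms(1-3)] g(2) by (auto simp: int_points_def)
qed

text \<open>As long as some \<open>p - h i\<close> leaves the span of the \<open>f i\<close> with \<open>i \<in> S \<inter> T\<close>, the set \<open>T\<close> is
  enlarged by the indices \<open>j\<close> of the nonzero coefficients of \<open>p - h i\<close>; the sign of the
  coefficient selects the endpoint of the segment \<open>f j\<close> that keeps the point maximal only for
  functionals vanishing on \<open>f j\<close>.\<close>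

lemma growth:
  assumes S: "S \<subseteq> {..<length Ps}" "\<And>i. i \<in> S \<Longrightarrow> f i \<in> D i"
    and T: "T \<subseteq> {..<length Ps}" "T \<noteq> {}" "card (S \<union> T) \<le> CARD('n)"
      "\<And>i. i \<in> S \<union> T \<Longrightarrow> D i \<subseteq> span (f ` S)"
      "\<And>i. i \<in> T \<Longrightarrow> h i \<in> Ps ! i" "sum h T \<in> int_lattice"
      "\<And>u i. (\<And>i y. i \<in> T \<Longrightarrow> y \<in> Ps ! i \<Longrightarrow> u \<bullet> y \<le> u \<bullet> h i) \<Longrightarrow> i \<in> S \<inter> T \<Longrightarrow> u \<bullet> f i = 0"
  shows False
  using T
proof (induction "card (S - T)" arbitrary: T h rule: less_induct)
  case less
  note T = less.prems
  have fin: "finite S" "finite T"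
    using S T finite_subset by blast+
  have diff: "y - h i \<in> span (f ` S)" if "i \<in> T" "y \<in> Ps ! i" for i y
    using that T lattice_polytope by (intro diff_in_span[of "Ps ! i"]) auto
  show False
  proof (cases "\<forall>i\<in>T. \<forall>y\<in>Ps ! i. y - h i \<in> span (f ` (S \<inter> T))")
    case True
    have "card T \<le> CARD('n)"
      using T(3) fin by (meson card_mono finite_UnI le_trans sup_ge2)
    then show False
    proof (rule hollowD[OF T(2,1) _ T(5,6)])
      \<comment> \<open>A functional maximal at the current point vanishes on the \<open>f i\<close>
        with \<open>i \<in> S \<inter> T\<close>. In this case their span contains all directions
        \<open>y - h i\<close>, so the functional is constant on every member.\<close>
      fix u i y assume "\<And>i y. i \<in> T \<Longrightarrow> y \<in> Ps ! i \<Longrightarrow> u \<bullet> y \<le> u \<bullet> h i"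
      then have "u \<bullet> f i = 0" if "i \<in> S \<inter> T" for i
        using T(7) that by blast
      moreover assume "i \<in> T" "y \<in> Ps ! i"
      ultimately have "u \<bullet> (y - h i) = 0"
        using True orthogonal_to_span_image by blast
      then show "u \<bullet> y = u \<bullet> h i"
        by (simp add: inner_diff_right)
    qed auto
  next
    case False
    then obtain i0 p where p: "i0 \<in> T" "p \<in> Ps ! i0" "p - h i0 \<notin> span (f ` (S \<inter> T))"
      by blast
    obtain c where c: "p - h i0 = (\<Sum>i\<in>S. c i *\<^sub>R f i)"
      using in_span_image_finite[OF fin(1) diff[OF p(1,2)]] .
    define N where "N = {j \<in> S - T. c j \<noteq> 0}"
    have N: "N \<subseteq> S" "N \<inter> T = {}" "finite N"
      using fin by (auto simp: N_def)
    have "N \<noteq> {}"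
    proof
      assume "N = {}"
      then have "(\<Sum>i\<in>S. c i *\<^sub>R f i) = (\<Sum>i\<in>S \<inter> T. c i *\<^sub>R f i)"
        using fin by (intro sum.mono_neutral_right) (auto simp: N_def)
      then show False
        using p(3) c sum_in_span_image by metis
    qed
    have "\<exists>g g'. g \<in> Ps ! j \<inter> int_lattice \<and> g' \<in> Ps ! j \<and> g - g' = sgn (c j) *\<^sub>R f j" if "j \<in> N" for j
    proof -
      have j: "c j \<noteq> 0" "f j \<in> D j"
        using that S N by (auto simp: N_def)
      then have "sgn (c j) *\<^sub>R f j \<in> D j"
        using lattice_diffs_uminus[OF j(2)] by (auto simp: sgn_real_def)
      then show ?thesis
        by (force simp: lattice_diffs_def)
    qed
    then obtain g g' where g: "\<And>j. j \<in> N \<Longrightarrow> g j \<in> Ps ! j \<inter> int_lattice" "\<And>j. j \<in> N \<Longrightarrow> g' j \<in> Ps ! j"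
      "\<And>j. j \<in> N \<Longrightarrow> g j - g' j = sgn (c j) *\<^sub>R f j"
      by metis
    define k where "k = (\<lambda>i. if i \<in> T then h i else g i)"
    show False
    proof (rule less.hyps[of "T \<union> N" k])
      show "card (S - (T \<union> N)) < card (S - T)"
        using \<open>N \<noteq> {}\<close> N fin by (intro psubset_card_mono) auto
      show "T \<union> N \<subseteq> {..<length Ps}" "T \<union> N \<noteq> {}"
        using T N S by auto
      \<comment> \<open>\<open>N\<close> lies in \<open>S\<close>, so enlarging \<open>T\<close>
        leaves the union unchanged and the bound on its cardinality survives.\<close>
      have "S \<union> (T \<union> N) = S \<union> T"
        using N by auto
      then show "card (S \<union> (T \<union> N)) \<le> CARD('n)"
        "\<And>i. i \<in> S \<union> (T \<union> N) \<Longrightarrow> D i \<subseteq> span (f ` S)"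
        using T(3,4) by auto
      show "k i \<in> Ps ! i" if "i \<in> T \<union> N" for i
        using that T(5) g(1) by (auto simp: k_def)
      have "sum k (T \<union> N) = sum k T + sum k N"
        using fin N by (intro sum.union_disjoint) auto
      moreover have "sum k T = sum h T"
        by (auto simp: k_def)
      moreover have "sum k N = sum g N"
        using N by (intro sum.cong) (auto simp: k_def)
      moreover have "sum g N \<in> int_lattice"
        using g by (intro int_lattice_sum) auto
      ultimately show "sum k (T \<union> N) \<in> int_lattice"
        using T(6) int_lattice_add by auto
      fix u i assume u: "\<And>i y. i \<in> T \<union> N \<Longrightarrow> y \<in> Ps ! i \<Longrightarrow> u \<bullet> y \<le> u \<bullet> k i"
      assume i: "i \<in> S \<inter> (T \<union> N)"
      have uh: "u \<bullet> y \<le> u \<bullet> h i" if "i \<in> T" "y \<in> Ps ! i" for i y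
        using u[of i y] that by (auto simp: k_def)
      have uf: "u \<bullet> f i = 0" if "i \<in> S \<inter> T" for i
        using T(7) uh that by blast
      have ug: "0 \<le> c j * (u \<bullet> f j)" if "j \<in> N" for j
      proof -
        have "u \<bullet> g' j \<le> u \<bullet> g j"
          using u[of j "g' j"] that g(2) N by (auto simp: k_def split: if_splits)
        then have "0 \<le> sgn (c j) * (u \<bullet> f j)"
          using g(3)[OF that] by (metis diff_ge_0_iff_ge inner_diff_right inner_scaleR_right)
        then show ?thesis
          by (auto simp: sgn_real_def zero_le_mult_iff split: if_splits)
      qed
      \<comment> \<open>Maximality of \<open>h i0\<close> makes
        \<open>u \<bullet> (p - h i0)\<close> nonpositive, while its expansion over \<open>N\<close>
        has only nonnegative terms by \<open>ug\<close>; hence every term vanishes.\<close>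
      have "(\<Sum>j\<in>N. c j * (u \<bullet> f j)) = (\<Sum>j\<in>S. c j * (u \<bullet> f j))"
        using fin N uf by (intro sum.mono_neutral_left) (auto simp: N_def)
      also have "\<dots> = u \<bullet> (p - h i0)"
        by (simp add: c inner_sum_right)
      also have "\<dots> \<le> 0"
        using uh p by (simp add: inner_diff_right)
      finally have "(\<Sum>j\<in>N. c j * (u \<bullet> f j)) = 0"
        using sum_nonneg[of N "\<lambda>j. c j * (u \<bullet> f j)"] ug by simp
      then have "\<forall>j\<in>N. c j * (u \<bullet> f j) = 0"
        using sum_nonneg_eq_0_iff[of N "\<lambda>j. c j * (u \<bullet> f j)"] ug N(3) by simp
      then show "u \<bullet> f i = 0"
        using i uf by (auto simp: N_def)
    qed
  qed
qed

end

section \<open>Transversals and exchange\<close>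

context hollow_family
begin

text \<open>An independent partial transversal in the sense of Rado. Independence of the image set
  does not detect repeated vectors, hence the separate injectivity.\<close>

definition transversal :: "(nat \<Rightarrow> real ^ 'n) \<Rightarrow> nat set \<Rightarrow> bool" where
  "transversal f S \<longleftrightarrow> S \<subseteq> {..<length Ps} \<and> (\<forall>i\<in>S. f i \<in> D i) \<and> inj_on f S \<and> independent (f ` S)"

lemma transversal_finite: "transversal f S \<Longrightarrow> finite S"
  unfolding transversal_def using finite_subset by blast

lemma transversal_card_le: "transversal f S \<Longrightarrow> card S \<le> CARD('n)"
  using independent_bound[of "f ` S"] by (auto simp: transversal_def card_image)

lemma transversal_subset: "transversal f S \<Longrightarrow> S' \<subseteq> S \<Longrightarrow> transversal f S'"
  unfolding transversal_def by (meson image_mono independent_mono inj_on_subset subset_eq)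

lemma transversal_spanning:
  "transversal f S \<Longrightarrow> card S = CARD('n) \<Longrightarrow> span (f ` S) = UNIV"
  using independent_family_spanning[of S f] transversal_finite by (auto simp: transversal_def)

lemma transversal_coeffs_eq:
  assumes "transversal f S" "(\<Sum>i\<in>S. a i *\<^sub>R f i) = (\<Sum>i\<in>S. b i *\<^sub>R f i)" "i \<in> S"
  shows "a i = b i"
  using independent_family_coeffs_eq[OF transversal_finite[OF assms(1)] _ _ assms(2,3)] assms(1)
  by (auto simp: transversal_def)

lemma transversal_insert:
  assumes "transversal f S" "k < length Ps" "k \<notin> S" "d \<in> D k" "d \<notin> span (f ` S)"
  shows "transversal (f(k := d)) (insert k S)"
proof -
  have "f(k := d) ` insert k S = insert d (f ` S)"
    using assms(3) by auto
  moreover have "inj_on (f(k := d)) (insert k S)"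
    using assms span_base[of d "f ` S"] by (auto simp: transversal_def inj_on_def)
  ultimately show ?thesis
    using assms by (auto simp: transversal_def independent_insert)
qed

lemma transversal_swap:
  assumes "transversal f S" "i \<in> S" "k < length Ps" "k \<notin> S" "d \<in> D k" "d \<notin> span (f ` (S - {i}))"
  shows "transversal (f(k := d)) (insert k (S - {i}))"
  using assms by (intro transversal_insert transversal_subset[OF assms(1)]) auto

text \<open>A lattice point with a fractional coordinate would, after reduction modulo the \<open>f i\<close>, lie in
  the relative interior of a parallelepiped spanned by segments of some of the polytopes.\<close>

lemma transversal_lattice_coeffs:
  assumes f: "transversal f S" "card S = CARD('n)"
    and y: "(\<Sum>i\<in>S. c i *\<^sub>R f i) \<in> int_lattice" and "i \<in> S"
  shows "c i \<in> \<int>"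
proof (rule ccontr)
  assume "c i \<notin> \<int>"
  define T where "T = {i \<in> S. c i \<notin> \<int>}"
  have "T \<noteq> {}" "T \<subseteq> S"
    using \<open>i \<in> S\<close> \<open>c i \<notin> \<int>\<close> by (auto simp: T_def)
  have "\<exists>p q. p \<in> Ps ! i \<inter> int_lattice \<and> q \<in> Ps ! i \<inter> int_lattice \<and> f i = p - q" if "i \<in> S" for i
    using f that unfolding transversal_def lattice_diffs_def by blast
  then obtain p q where pq: "\<And>i. i \<in> S \<Longrightarrow> p i \<in> Ps ! i \<inter> int_lattice"
    "\<And>i. i \<in> S \<Longrightarrow> q i \<in> Ps ! i \<inter> int_lattice" "\<And>i. i \<in> S \<Longrightarrow> f i = p i - q i"
    by metis
  \<comment> \<open>\<open>h i\<close> is the point at parameter \<open>frac (c i)\<close> on the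
    segment from \<open>q i\<close> to \<open>p i\<close>; for \<open>i\<close> in \<open>T\<close>
    it lies strictly between the endpoints.\<close>
  define h where "h = (\<lambda>i. q i + frac (c i) *\<^sub>R f i)"
  have f_lat: "f i \<in> int_lattice" if "i \<in> S" for i
    using f that lattice_diffs_int_lattice by (auto simp: transversal_def)
  have fin: "finite S"
    using f transversal_finite by blast
  show False
  proof (rule growth[of S f T h])
    show "S \<subseteq> {..<length Ps}" "\<And>i. i \<in> S \<Longrightarrow> f i \<in> D i"
      using f by (auto simp: transversal_def)
    then show "T \<subseteq> {..<length Ps}" using \<open>T \<subseteq> S\<close> by auto
    show "T \<noteq> {}" by fact
    show "card (S \<union> T) \<le> CARD('n)"
      using f \<open>T \<subseteq> S\<close> by (simp add: Un_absorb2)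
    show "D i \<subseteq> span (f ` S)" for i
      using transversal_spanning f by auto
    show "h i \<in> Ps ! i" if "i \<in> T" for i
    proof -
      have "i \<in> S" using that \<open>T \<subseteq> S\<close> by auto
      moreover have "i < length Ps"
        using \<open>i \<in> S\<close> f by (auto simp: transversal_def)
      ultimately have "(1 - frac (c i)) *\<^sub>R q i + frac (c i) *\<^sub>R p i \<in> Ps ! i"
        using pq frac_lt_1[of "c i"] lattice_polytope_imp_convex[OF lattice_polytope]
        by (intro convexD) (auto simp: less_imp_le)
      then show ?thesis
        by (simp add: h_def pq(3)[OF \<open>i \<in> S\<close>] algebra_simps)
    qed
    have "(\<Sum>i\<in>S. frac (c i) *\<^sub>R f i) = (\<Sum>i\<in>S. c i *\<^sub>R f i) - (\<Sum>i\<in>S. of_int \<lfloor>c i\<rfloor> *\<^sub>R f i)"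
      by (simp add: frac_def scaleR_left_diff_distrib sum_subtractf)
    moreover have "(\<Sum>i\<in>T. frac (c i) *\<^sub>R f i) = (\<Sum>i\<in>S. frac (c i) *\<^sub>R f i)"
      using fin by (intro sum.mono_neutral_left) (auto simp: T_def)
    moreover have "(\<Sum>i\<in>S. of_int \<lfloor>c i\<rfloor> *\<^sub>R f i) \<in> int_lattice"
      using f_lat by (intro int_lattice_sum int_lattice_scaleR) auto
    moreover have "sum q T \<in> int_lattice"
      using pq \<open>T \<subseteq> S\<close> by (intro int_lattice_sum) auto
    ultimately show "sum h T \<in> int_lattice"
      using y by (simp add: h_def sum.distrib int_lattice_add int_lattice_diff)
    fix u i assume u: "\<And>i y. i \<in> T \<Longrightarrow> y \<in> Ps ! i \<Longrightarrow> u \<bullet> y \<le> u \<bullet> h i"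
    assume "i \<in> S \<inter> T"
    then have i: "i \<in> S" "i \<in> T" by auto
    have fr: "0 < frac (c i)" "frac (c i) < 1"
      using i by (auto simp: T_def frac_lt_1)
    \<comment> \<open>A functional maximal at an inner point of a segment is constant on the
      segment.\<close>
    have "u \<bullet> q i \<le> u \<bullet> h i" "u \<bullet> p i \<le> u \<bullet> h i"
      using u i pq by auto
    then have "0 \<le> frac (c i) * (u \<bullet> f i)" "(1 - frac (c i)) * (u \<bullet> f i) \<le> 0"
      by (simp_all add: h_def pq(3)[OF i(1)] inner_add_right inner_diff_right algebra_simps)
    then show "u \<bullet> f i = 0"
      using fr by (simp add: zero_le_mult_iff mult_le_0_iff)
  qed
qed

text \<open>If \<open>c i\<close> is nonzero, exchanging \<open>f i\<close> for the difference gives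
  another lattice basis, in which \<open>f i\<close> has an integral coefficient \<open>b k\<close>
  with \<open>b k * c i = 1\<close>. As \<open>c i\<close> is integral too, it is 1 or -1.\<close>

lemma transversal_coeffs_bound:
  assumes f: "transversal f S" "card S = CARD('n)"
    and k: "k < length Ps" "k \<notin> S" "(\<Sum>i\<in>S. c i *\<^sub>R f i) \<in> D k" and i: "i \<in> S"
  shows "\<bar>c i\<bar> \<le> 1"
proof (cases "c i = 0")
  case False
  define d where "d = (\<Sum>i\<in>S. c i *\<^sub>R f i)"
  define S' where "S' = insert k (S - {i})"
  define f' where "f' = f(k := d)"
  have fin: "finite S"
    using f transversal_finite by blast
  have "d \<notin> span (f ` (S - {i}))"
  proof
    assume "d \<in> span (f ` (S - {i}))"
    then obtain b where b: "d = (\<Sum>j\<in>S - {i}. b j *\<^sub>R f j)"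
      using in_span_image_finite fin by (metis finite_Diff)
    also have "\<dots> = (\<Sum>j\<in>S. (b(i := 0)) j *\<^sub>R f j)"
      using fin i by (intro sum.mono_neutral_cong_left) auto
    finally have "c i = (b(i := 0)) i"
      unfolding d_def by (rule transversal_coeffs_eq[OF f(1) _ i])
    then show False using False by simp
  qed
  then have f': "transversal f' S'"
    unfolding f'_def S'_def using f k i by (intro transversal_swap) (auto simp: d_def)
  have "card S' = CARD('n)"
    unfolding S'_def using f(2) i k(2) fin by (simp add: card_Suc_Diff1)
  have "f i \<in> int_lattice"
    using f i lattice_diffs_int_lattice by (auto simp: transversal_def)
  obtain b where b: "f i = (\<Sum>j\<in>S'. b j *\<^sub>R f' j)"
    using in_span_image_finite[of S' "f i" f'] transversal_spanning[OF f' \<open>card S' = _\<close>]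
      transversal_finite[OF f'] by auto
  have "b k \<in> \<int>"
    using transversal_lattice_coeffs[OF f' \<open>card S' = _\<close>, of b k] b \<open>f i \<in> int_lattice\<close>
    by (auto simp: S'_def)
  have "f i = b k *\<^sub>R d + (\<Sum>j\<in>S - {i}. b j *\<^sub>R f' j)"
    using b k fin by (simp add: S'_def f'_def)
  also have "(\<Sum>j\<in>S - {i}. b j *\<^sub>R f' j) = (\<Sum>j\<in>S. (b(i := 0)) j *\<^sub>R f j)"
    using fin i k by (intro sum.mono_neutral_cong_left) (auto simp: f'_def)
  finally have "(\<Sum>j\<in>S. (if j = i then 1 else 0) *\<^sub>R f j) = (\<Sum>j\<in>S. (b k * c j + (b(i := 0)) j) *\<^sub>R f j)"
    using fin i by (simp add: d_def scaleR_add_left sum.distrib scaleR_sum_right if_distrib[of "\<lambda>x. x *\<^sub>R _"] sum.delta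
        cong: if_cong)
  from transversal_coeffs_eq[OF f(1) this i] have "b k * c i = 1"
    by simp
  moreover have "c i \<in> \<int>"
    using transversal_lattice_coeffs[OF f _ i] k lattice_diffs_int_lattice by blast
  ultimately obtain x y where "b k = of_int x" "c i = of_int y" "x * y = 1"
    using \<open>b k \<in> \<int>\<close> by (metis Ints_cases of_int_1 of_int_eq_iff of_int_mult)
  then have "\<bar>y\<bar> = 1"
    by (metis abs_zmult_eq_1 mult.commute abs_1)
  then show ?thesis
    using \<open>c i = of_int y\<close> by linarith
qed simp

text \<open>Breadth-first search in the exchange graph: an edge from \<open>k\<close> to
  \<open>j\<close> means that some difference of member \<open>k\<close> can replace the vector
  \<open>e j\<close> without losing independence. The last argument bounds the distance from
  \<open>l\<close>.\<close>

primrec reach :: "(nat \<Rightarrow> real ^ 'n) \<Rightarrow> nat set \<Rightarrow> nat \<Rightarrow> nat \<Rightarrow> nat set" where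
  "reach e S l 0 = {l}"
| "reach e S l (Suc s) = reach e S l s \<union> {j \<in> S. \<exists>k\<in>reach e S l s. \<not> D k \<subseteq> span (e ` (S - {j}))}"

lemma reach_mono: "r \<le> s \<Longrightarrow> reach e S l r \<subseteq> reach e S l s"
  by (rule lift_Suc_mono_le) auto

lemma reach_subset: "reach e S l s \<subseteq> insert l S"
  by (induction s) auto

lemma lattice_diffs_in_span_reach:
  assumes "i \<in> reach e S l r" "r < s" "j \<in> S - reach e S l s"
  shows "D i \<subseteq> span (e ` (S - {j}))"
proof -
  have "j \<notin> reach e S l (Suc r)"
    using reach_mono[of "Suc r" s e S l] assms by auto
  then show ?thesis
    using assms by auto
qed

text \<open>Augmentation along a shortest path from \<open>l\<close> to \<open>k\<close>; being shortest means that every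
  vector exchanged before stays in the span of the vectors kept.\<close>

lemma transversal_exchange:
  assumes e: "transversal e S" "l < length Ps" "l \<notin> S" and "k \<in> reach e S l s"
  shows "\<exists>f. transversal f (insert l S - {k}) \<and>
    (\<forall>i\<in>insert l S - {k}. i \<in> S \<and> f i = e i \<or> (\<exists>r<s. i \<in> reach e S l r))"
  using \<open>k \<in> reach e S l s\<close>
proof (induction s arbitrary: k)
  case 0
  then show ?case
    using e by (intro exI[of _ e]) auto
next
  case (Suc s)
  show ?case
  proof (cases "k \<in> reach e S l s")
    case True
    then show ?thesis
      using Suc.IH less_SucI by metis
  next
    case False
    then obtain k' d where k: "k \<in> S" "k' \<in> reach e S l s" "d \<in> D k'" "d \<notin> span (e ` (S - {k}))"
      using Suc.prems by auto
    \<comment> \<open>The induction hypothesis frees \<open>k'\<close>; giving \<open>k'\<close> the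
      difference \<open>d\<close> makes it possible to drop \<open>k\<close> instead.\<close>
    obtain f where f: "transversal f (insert l S - {k'})"
      "\<And>i. i \<in> insert l S - {k'} \<Longrightarrow> i \<in> S \<and> f i = e i \<or> (\<exists>r<s. i \<in> reach e S l r)"
      using Suc.IH[OF k(2)] by blast
    have k': "k' \<in> insert l S" "k \<noteq> k'"
      using k False reach_subset by blast+
    have "f i \<in> span (e ` (S - {k}))" if "i \<in> insert l S - {k'} - {k}" for i
    proof (cases "i \<in> S \<and> f i = e i")
      case True
      then show ?thesis
        using that by (auto intro: span_base)
    next
      case False
      then have "D i \<subseteq> span (e ` (S - {k}))"
        using f(2)[of i] that lattice_diffs_in_span_reach \<open>k \<notin> reach e S l s\<close> k(1) by blast
      then show ?thesis
        using f(1) that by (auto simp: transversal_def)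
    qed
    then have "span (f ` (insert l S - {k'} - {k})) \<subseteq> span (e ` (S - {k}))"
      by (intro span_minimal) auto
    then have "d \<notin> span (f ` (insert l S - {k'} - {k}))"
      using k(4) by blast
    moreover have "k' < length Ps"
      using k' e by (auto simp: transversal_def)
    ultimately have "transversal (f(k' := d)) (insert k' (insert l S - {k'} - {k}))"
      using f(1) k k' by (intro transversal_swap) auto
    moreover have "insert k' (insert l S - {k'} - {k}) = insert l S - {k}"
      using k' by auto
    ultimately have "transversal (f(k' := d)) (insert l S - {k})"
      by simp
    moreover have "i \<in> S \<and> (f(k' := d)) i = e i \<or> (\<exists>r<Suc s. i \<in> reach e S l r)"
      if "i \<in> insert l S - {k}" for i
      using f(2)[of i] that k(2) less_SucI by (cases "i = k'") auto
    ultimately show ?thesis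
      by blast
  qed
qed

text \<open>Each condition outside \<open>C\<close> kills one coordinate, since coordinates with
  respect to \<open>e\<close> are unique.\<close>

lemma span_remove_coeffs:
  assumes e: "transversal e S" "C \<subseteq> S" and d: "d \<in> span (e ` S)" "\<And>j. j \<in> S - C \<Longrightarrow> d \<in> span (e ` (S - {j}))"
  shows "d \<in> span (e ` C)"
proof -
  have fin: "finite S"
    using e transversal_finite by blast
  obtain c where c: "d = (\<Sum>i\<in>S. c i *\<^sub>R e i)"
    using in_span_image_finite[OF fin d(1)] .
  have "c j = 0" if j: "j \<in> S - C" for j
  proof -
    obtain b where "d = (\<Sum>i\<in>S - {j}. b i *\<^sub>R e i)"
      using in_span_image_finite[OF _ d(2)[OF j]] fin by (metis finite_Diff)
    also have "\<dots> = (\<Sum>i\<in>S. (b(j := 0)) i *\<^sub>R e i)"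
      using fin j by (intro sum.mono_neutral_cong_left) auto
    finally show ?thesis
      using transversal_coeffs_eq[OF e(1), of c "b(j := 0)" j] c j by auto
  qed
  then have "d = (\<Sum>i\<in>C. c i *\<^sub>R e i)"
    unfolding c using fin e(2) by (intro sum.mono_neutral_right) auto
  then show ?thesis
    using sum_in_span_image by metis
qed

text \<open>Each layer is determined by the previous one, so the chain stops for good at its first
  idle step. The explicit bound on the number of steps is what makes the later coefficient bound
  depend on the dimension only.\<close>

lemma reach_stable: "(\<Union>s. reach e S l s) = reach e S l (card (insert l S))" if "finite S"
proof -
  have sub: "reach e S l s \<subseteq> insert l S" for s
    by (rule reach_subset)
  have "range (reach e S l) \<subseteq> Pow (insert l S)"
    using sub by (simp add: image_subset_iff)
  then have fr: "finite (range (reach e S l))"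
    using that by (meson finite_Pow_iff finite_insert finite_subset)
  have mono: "mono (reach e S l)"
    by (intro monoI reach_mono)
  have "\<exists>N. (\<forall>n\<le>N. \<forall>m\<le>N. m < n \<longrightarrow> reach e S l m \<subset> reach e S l n) \<and> (\<forall>n\<ge>N. reach e S l N = reach e S l n)"
    by (rule finite_mono_remains_stable_implies_strict_prefix[OF fr mono]) simp
  then show ?thesis
    using that by (intro finite_mono_strict_prefix_implies_finite_fixpoint[OF sub, symmetric]) simp_all
qed

text \<open>A largest transversal admits no augmentation, so the members reachable from
  \<open>l\<close> have their differences in the span of the reachable part of \<open>e\<close>. If
  at most \<open>CARD('n)\<close> indices were reachable, \<open>growth\<close> would contradict
  hollowness. Hence all of \<open>insert l S\<close> is reachable and \<open>S\<close> has full
  size.\<close>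

lemma exists_full_transversal:
  assumes "CARD('n) < length Ps"
  obtains e S l where "transversal e S" "card S = CARD('n)" "l < length Ps" "l \<notin> S"
    "reach e S l (Suc CARD('n)) = insert l S"
proof -
  have "\<exists>S. (\<exists>e. transversal e S) \<and> (\<forall>S'. (\<exists>e. transversal e S') \<longrightarrow> card S' \<le> card S)"
    using transversal_card_le
    by (intro ex_has_greatest_nat[of _ "{}" card "Suc CARD('n)"]) (auto simp: transversal_def less_Suc_eq_le independent_empty)
  then obtain e S where e: "transversal e S" "\<And>f S'. transversal f S' \<Longrightarrow> card S' \<le> card S"
    by blast
  have fin: "finite S" and cS: "card S \<le> CARD('n)"
    using e transversal_finite transversal_card_le by blast+
  have "\<not> {..<length Ps} \<subseteq> S"
    using cS assms card_mono[OF fin, of "{..<length Ps}"] by auto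
  then obtain l where l: "l < length Ps" "l \<notin> S"
    by auto
  define K where "K = (\<Union>s. reach e S l s)"
  have K: "K \<subseteq> insert l S"
    unfolding K_def by (intro UN_least reach_subset)
  \<comment> \<open>Freeing \<open>k\<close> along a shortest path and then giving it a difference
    outside the span would produce a transversal on \<open>insert l S\<close>, against the
    maximality of \<open>S\<close>.\<close>
  have D_span: "D k \<subseteq> span (e ` S)" if "k \<in> reach e S l s" for k s
    using that
  proof (induction s arbitrary: k rule: less_induct)
    case (less s)
    obtain f where f: "transversal f (insert l S - {k})"
      "\<And>i. i \<in> insert l S - {k} \<Longrightarrow> i \<in> S \<and> f i = e i \<or> (\<exists>r<s. i \<in> reach e S l r)"
      using transversal_exchange[OF e(1) l less.prems] by blast
    have k: "k \<in> insert l S"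
      using less.prems reach_subset by blast
    have "f i \<in> span (e ` S)" if i: "i \<in> insert l S - {k}" for i
    proof (cases "i \<in> S \<and> f i = e i")
      case False
      then obtain r where "r < s" "i \<in> reach e S l r"
        using f(2)[OF i] by blast
      then show ?thesis
        using less.IH f(1) i unfolding transversal_def by blast
    qed (auto intro: span_base)
    then have sub: "span (f ` (insert l S - {k})) \<subseteq> span (e ` S)"
      by (intro span_minimal) auto
    show ?case
    proof (rule ccontr)
      assume "\<not> D k \<subseteq> span (e ` S)"
      then obtain d where "d \<in> D k" "d \<notin> span (f ` (insert l S - {k}))"
        using sub by blast
      moreover have "k < length Ps"
        using k l e by (auto simp: transversal_def)
      ultimately have "transversal (f(k := d)) (insert k (insert l S - {k}))"
        using f(1) by (intro transversal_insert) auto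
      then have "card (insert k (insert l S - {k})) \<le> card S"
        using e(2) by blast
      then show False
        using k l fin by (simp add: insert_absorb)
    qed
  qed
  have "\<not> card K \<le> CARD('n)"
  proof
    assume cK: "card K \<le> CARD('n)"
    have lK: "l \<in> K" "K \<subseteq> insert l S"
      using K reach.simps(1)[of e S l] unfolding K_def by blast+
    obtain z where z: "z \<in> Ps ! l" "z \<in> int_lattice"
      using lattice_polytope_obtain_point lattice_polytope l by blast
    \<comment> \<open>\<open>K\<close> is closed under the edges of the exchange graph, so the
      coordinates of \<open>d\<close> at indices outside \<open>K\<close> vanish.\<close>
    have spanK: "D k \<subseteq> span (e ` (K \<inter> S))" if k: "k \<in> K" for k
    proof
      fix d assume d: "d \<in> D k"
      obtain s where s: "k \<in> reach e S l s"
        using k by (auto simp: K_def)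
      show "d \<in> span (e ` (K \<inter> S))"
      proof (rule span_remove_coeffs[OF e(1)])
        show "d \<in> span (e ` S)"
          using D_span s d by blast
        fix j assume "j \<in> S - K \<inter> S"
        then have "j \<in> S - reach e S l (Suc s)"
          unfolding K_def by blast
        then show "d \<in> span (e ` (S - {j}))"
          using lattice_diffs_in_span_reach[OF s lessI] d by blast
      qed auto
    qed
    \<comment> \<open>Growth starts at a single lattice point of member \<open>l\<close>; as
      \<open>l\<close> is not in \<open>S\<close>, the condition on functionals is vacuous.\<close>
    show False
    proof (rule growth[of "K \<inter> S" e "{l}" "\<lambda>_. z"])
      have "K \<inter> S \<union> {l} = K"
        using lK by auto
      then show "card (K \<inter> S \<union> {l}) \<le> CARD('n)" "\<And>i. i \<in> K \<inter> S \<union> {l} \<Longrightarrow> D i \<subseteq> span (e ` (K \<inter> S))"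
        using cK spanK by auto
    qed (use e l z in \<open>auto simp: transversal_def\<close>)
  qed
  moreover have "card (insert l S) = Suc (card S)"
    using l fin by simp
  ultimately have "card S = CARD('n)" "K = insert l S"
    using K cS card_mono[of "insert l S" K] card_subset_eq[of "insert l S" K] fin by auto
  \<comment> \<open>\<open>Suc CARD('n)\<close> is the size of \<open>insert l S\<close>, the stage
    at which the layers are known to be stable.\<close>
  then show ?thesis
    using that[OF e(1) _ l] reach_stable[OF fin, of e l] \<open>card (insert l S) = _\<close> by (simp add: K_def)
qed

text \<open>Freeing \<open>k\<close> makes it an outsider, so its differences have coefficients of
  absolute value at most 1 in the new basis \<open>f\<close>. Re-expanding \<open>f\<close> in
  \<open>e\<close> costs one factor \<open>CARD('n)\<close> per layer.\<close>

lemma reach_coeffs_bound: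
  assumes e: "transversal e S" "card S = CARD('n)" "l < length Ps" "l \<notin> S"
    and "k \<in> reach e S l s" "(\<Sum>i\<in>S. c i *\<^sub>R e i) \<in> D k" "j \<in> S"
  shows "\<bar>c j\<bar> \<le> real CARD('n) ^ Suc s"
  using assms(5-7)
proof (induction s arbitrary: k c j rule: less_induct)
  case (less s)
  define n where "n = CARD('n)"
  have n: "1 \<le> n"
    by (simp add: n_def)
  obtain f where f: "transversal f (insert l S - {k})"
    "\<And>i. i \<in> insert l S - {k} \<Longrightarrow> i \<in> S \<and> f i = e i \<or> (\<exists>r<s. i \<in> reach e S l r)"
    using transversal_exchange[OF e(1,3,4) less.prems(1)] by blast
  have fin: "finite S"
    using e transversal_finite by blast
  have k: "k \<in> insert l S" "k < length Ps"
    using less.prems(1) reach_subset[of e S l s] e by (auto simp: transversal_def)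
  have card: "card (insert l S - {k}) = CARD('n)"
    using k e fin by simp
  \<comment> \<open>Vectors kept from \<open>e\<close> are unit vectors in these coordinates; the
    others belong to earlier layers, where the induction hypothesis gives \<open>n ^ Suc r\<close>
    with \<open>Suc r \<le> s\<close>.\<close>
  have "\<exists>a. f i = (\<Sum>j\<in>S. a j *\<^sub>R e j) \<and> (\<forall>j\<in>S. \<bar>a j\<bar> \<le> real n ^ s)" if i: "i \<in> insert l S - {k}" for i
  proof (cases "i \<in> S \<and> f i = e i")
    case True
    then have "f i = (\<Sum>j\<in>S. (if j = i then 1 else 0) *\<^sub>R e j)"
      using fin by (simp add: if_distrib[of "\<lambda>x. x *\<^sub>R _"] sum.delta cong: if_cong)
    moreover have "1 \<le> real n ^ s"
      using n by simp
    ultimately show ?thesis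
      by (intro exI[of _ "\<lambda>j. if j = i then 1 else 0"]) auto
  next
    case False
    then obtain r where r: "r < s" "i \<in> reach e S l r"
      using f(2)[OF i] by blast
    obtain a where a: "f i = (\<Sum>j\<in>S. a j *\<^sub>R e j)"
      using in_span_image_finite[OF fin, of "f i" e] transversal_spanning[OF e(1,2)] by auto
    have "f i \<in> D i"
      using f(1) i by (auto simp: transversal_def)
    then have "\<bar>a j\<bar> \<le> real n ^ Suc r" if "j \<in> S" for j
      using less.IH[OF r] a that by (simp add: n_def)
    moreover have "real n ^ Suc r \<le> real n ^ s"
      using r n by (intro power_increasing) auto
    ultimately show ?thesis
      using a order_trans by blast
  qed
  then obtain a where a: "\<And>i. i \<in> insert l S - {k} \<Longrightarrow> f i = (\<Sum>j\<in>S. a i j *\<^sub>R e j)"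
    "\<And>i j. i \<in> insert l S - {k} \<Longrightarrow> j \<in> S \<Longrightarrow> \<bar>a i j\<bar> \<le> real n ^ s"
    by metis
  define d where "d = (\<Sum>i\<in>S. c i *\<^sub>R e i)"
  obtain b where b: "d = (\<Sum>i\<in>insert l S - {k}. b i *\<^sub>R f i)"
    using in_span_image_finite[of "insert l S - {k}" d f] transversal_spanning[OF f(1) card] fin by auto
  have b1: "\<bar>b i\<bar> \<le> 1" if "i \<in> insert l S - {k}" for i
    using transversal_coeffs_bound[OF f(1) card k(2) _ _ that] b less.prems(2) by (auto simp: d_def)
  have "d = (\<Sum>i\<in>insert l S - {k}. \<Sum>j\<in>S. (b i * a i j) *\<^sub>R e j)"
    unfolding b using a(1) by (intro sum.cong) (auto simp: scaleR_sum_right)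
  also have "\<dots> = (\<Sum>j\<in>S. (\<Sum>i\<in>insert l S - {k}. b i * a i j) *\<^sub>R e j)"
    by (subst sum.swap) (simp add: scaleR_sum_left)
  finally have "c j = (\<Sum>i\<in>insert l S - {k}. b i * a i j)"
    unfolding d_def by (rule transversal_coeffs_eq[OF e(1) _ less.prems(3)])
  also have "\<bar>\<dots>\<bar> \<le> (\<Sum>i\<in>insert l S - {k}. \<bar>b i * a i j\<bar>)"
    by (rule sum_abs)
  also have "\<dots> \<le> (\<Sum>i\<in>insert l S - {k}. 1 * real n ^ s)"
    unfolding abs_mult using a(2) b1 less.prems(3) by (intro sum_mono mult_mono) auto
  finally show ?case
    using card by (simp add: n_def)
qed

end

section \<open>Boundedness and finiteness\<close>

lemma det_Ints:
  fixes A :: "real ^ 'n ^ 'n"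
  assumes "\<And>i j. A $ i $ j \<in> \<int>"
  shows "det A \<in> \<int>"
  unfolding det_def using assms by (intro Ints_sum Ints_mult Ints_prod) auto

text \<open>From the image back to \<open>x\<close>, Cramer's rule writes each coordinate as an
  integral determinant divided by 1 or -1.\<close>

lemma unimodular_int_lattice_iff:
  fixes A :: "real ^ 'n ^ 'n::finite"
  assumes A: "\<And>i j. A $ i $ j \<in> \<int>" "\<bar>det A\<bar> = 1"
  shows "A *v x \<in> int_lattice \<longleftrightarrow> x \<in> int_lattice"
proof
  assume "x \<in> int_lattice"
  then show "A *v x \<in> int_lattice"
    using A by (auto simp: int_lattice_def matrix_vector_mult_def intro!: Ints_sum)
next
  define b where "b = A *v x"
  assume "A *v x \<in> int_lattice"
  then have "b $ i \<in> \<int>" for i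
    by (simp add: b_def int_lattice_def)
  then have "det (\<chi> i j. if j = k then b $ i else A $ i $ j) \<in> \<int>" for k
    using A by (intro det_Ints) auto
  moreover have "det A = 1 \<or> det A = - 1"
    using A(2) by linarith
  moreover have "x = (\<chi> k. det (\<chi> i j. if j = k then b $ i else A $ i $ j) / det A)"
    using cramer[of A x b] A(2) by (auto simp: b_def)
  ultimately show "x \<in> int_lattice"
    unfolding int_lattice_def by (auto simp: vec_eq_iff)
qed

lemma affine_unimodular_int_lattice_iff:
  assumes "affine_unimodular \<phi>"
  shows "\<phi> x \<in> int_lattice \<longleftrightarrow> x \<in> int_lattice"
proof -
  obtain A b where A: "\<And>i j. A $ i $ j \<in> \<int>" "\<bar>det A\<bar> = 1" "b \<in> int_lattice" "\<phi> = (\<lambda>x. A *v x + b)"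
    using assms unfolding affine_unimodular_def by blast
  have "\<phi> x \<in> int_lattice \<longleftrightarrow> A *v x \<in> int_lattice"
    using int_lattice_add[of "A *v x" b] int_lattice_diff[of "A *v x + b" b] A(3,4) by auto
  then show ?thesis
    using unimodular_int_lattice_iff[OF A(1,2)] by simp
qed

lemma finite_int_lattice_box:
  "finite {x \<in> int_lattice :: (real ^ 'n::finite) set. \<forall>i. \<bar>x $ i\<bar> \<le> M}"
proof -
  define K where "K = {k \<in> \<int>. \<bar>k\<bar> \<le> M}"
  have "{x \<in> int_lattice :: (real ^ 'n) set. \<forall>i. \<bar>x $ i\<bar> \<le> M} \<subseteq> (\<lambda>f. \<chi> i. f i) ` (UNIV \<rightarrow>\<^sub>E K)"
  proof
    fix x :: "real ^ 'n"
    assume "x \<in> {x \<in> int_lattice. \<forall>i. \<bar>x $ i\<bar> \<le> M}"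
    then have "($) x \<in> UNIV \<rightarrow>\<^sub>E K"
      by (auto simp: K_def int_lattice_def)
    then show "x \<in> (\<lambda>f. \<chi> i. f i) ` (UNIV \<rightarrow>\<^sub>E K)"
      by (intro image_eqI[of _ _ "($) x"]) (auto simp: vec_eq_iff)
  qed
  moreover have "finite (UNIV \<rightarrow>\<^sub>E K :: ('n \<Rightarrow> real) set)"
    unfolding K_def by (intro finite_PiE finite_abs_int_segment) auto
  ultimately show ?thesis
    using finite_subset by blast
qed

text \<open>Indexing by subsets of a finite set of lattice points, rather than by polytopes inside
  the box, reduces finiteness to that of a power set.\<close>

definition box_polytopes :: "real \<Rightarrow> (real ^ 'n::finite) set set" where
  "box_polytopes M = (hull) convex ` {Y. Y \<noteq> {} \<and> Y \<subseteq> {x \<in> int_lattice. \<forall>i. \<bar>x $ i\<bar> \<le> M}}"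

lemma finite_box_polytopes: "finite (box_polytopes M)"
  unfolding box_polytopes_def
  by (intro finite_imageI finite_subset[OF _ finite_Pow_iff[THEN iffD2, OF finite_int_lattice_box[of M]]]) auto

lemma lattice_polytope_hull:
  assumes "finite Y" "Y \<noteq> {}" "Y \<subseteq> int_lattice"
  shows "lattice_polytope (convex hull Y)"
  using assms extreme_point_of_convex_hull[of _ Y] by (auto simp: lattice_polytope_def polytope_convex_hull)

lemma box_polytopes_lattice_polytope: "P \<in> box_polytopes M \<Longrightarrow> lattice_polytope P"
  using lattice_polytope_hull finite_subset[OF _ finite_int_lattice_box[of M]]
  unfolding box_polytopes_def by blast

lemma aff_dim_lattice_polytope:
  assumes "lattice_polytope P" "x0 \<in> P \<inter> int_lattice"
  shows "aff_dim P = int (dim ((\<lambda>x. x - x0) ` (P \<inter> int_lattice)))"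
proof -
  have "aff_dim P = aff_dim (P \<inter> int_lattice)"
    using lattice_polytope_eq_hull[OF assms(1)] aff_dim_convex_hull by metis
  also have "\<dots> = int (dim ((\<lambda>x. x - x0) ` (P \<inter> int_lattice)))"
    using assms(2) by (intro aff_dim_eq_dim_subtract) (simp add: hull_inc)
  finally show ?thesis .
qed

lemma lattice_polytope_diff_basis:
  fixes P :: "(real ^ 'n::finite) set"
  assumes "lattice_polytope P" "x0 \<in> P \<inter> int_lattice"
  obtains B where "B \<subseteq> (\<lambda>x. x - x0) ` (P \<inter> int_lattice)" "independent B" 
    "lattice_diffs P \<subseteq> span B" "int (card B) = aff_dim P"
proof -
  obtain B where B: "B \<subseteq> (\<lambda>x. x - x0) ` (P \<inter> int_lattice)" "independent B"
    "(\<lambda>x. x - x0) ` (P \<inter> int_lattice) \<subseteq> span B" "card B = dim ((\<lambda>x. x - x0) ` (P \<inter> int_lattice))"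
    using basis_exists by blast
  have "p - q \<in> span B" if "p \<in> P \<inter> int_lattice" "q \<in> P \<inter> int_lattice" for p q
    using span_diff[of "p - x0" B "q - x0"] B(3) that by auto
  then have "lattice_diffs P \<subseteq> span B"
    by (auto simp: lattice_diffs_def)
  then show ?thesis
    using that B aff_dim_lattice_polytope[OF assms] by simp
qed

lemma lattice_translate_lattice_diffs: "lattice_translate A B \<Longrightarrow> lattice_diffs A = lattice_diffs B"
  by (auto simp: lattice_translate_def lattice_diffs_translation)

lemma lattice_translate_aff_dim: "lattice_translate A B \<Longrightarrow> aff_dim A = aff_dim B"
  by (auto simp: lattice_translate_def aff_dim_translation_eq)

lemma sum_UNIV_option:
  fixes f :: "'b::finite option \<Rightarrow> 'a::comm_monoid_add"
  shows "sum f UNIV = f None + (\<Sum>i\<in>UNIV. f (Some i))"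
  by (simp add: UNIV_option_conv sum.reindex)

context hollow_family
begin

text \<open>By \<open>transversal_lattice_coeffs\<close> the chosen differences form a lattice
  basis, so the matrix \<open>B\<close> with these columns has an integral inverse \<open>A\<close>;
  both determinants are integers with product 1. The bijection \<open>\<tau>\<close> indexes the
  basis by coordinates.\<close>

lemma transversal_unimodular:
  fixes \<tau> :: "'n \<Rightarrow> nat"
  assumes f: "transversal f S" "card S = CARD('n)" and \<tau>: "bij_betw \<tau> UNIV S"
  obtains A B :: "real ^ 'n ^ 'n" where
    "\<And>i j. A $ i $ j \<in> \<int>" "\<bar>det A\<bar> = 1" "\<And>i j. B $ i $ j \<in> \<int>" "\<bar>det B\<bar> = 1"
    "\<And>x. A *v (B *v x) = x" "\<And>x. B *v (A *v x) = x"
    "\<And>x. B *v x = (\<Sum>i\<in>UNIV. x $ i *\<^sub>R f (\<tau> i))"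
proof -
  define B :: "real ^ 'n ^ 'n" where "B = transpose (\<chi> i. f (\<tau> i))"
  have B: "B *v x = (\<Sum>i\<in>UNIV. x $ i *\<^sub>R f (\<tau> i))" for x
    by (simp add: B_def matrix_mult_sum scalar_mult_eq_scaleR column_transpose row_def)
  have fin: "finite S"
    using f transversal_finite by blast
  have "\<exists>x \<in> int_lattice. B *v x = y" if y: "y \<in> int_lattice" for y
  proof -
    obtain c where c: "y = (\<Sum>i\<in>S. c i *\<^sub>R f i)"
      using in_span_image_finite[OF fin, of y f] transversal_spanning[OF f] by auto
    have "\<tau> i \<in> S" for i
      using \<tau> bij_betwE by blast
    then have "(\<chi> i. c (\<tau> i)) \<in> int_lattice"
      using transversal_lattice_coeffs[OF f, of c] c y by (auto simp: int_lattice_def)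
    moreover have "B *v (\<chi> i. c (\<tau> i)) = y"
      unfolding B c using sum.reindex_bij_betw[OF \<tau>, of "\<lambda>i. c i *\<^sub>R f i"] by simp
    ultimately show ?thesis by blast
  qed
  moreover have "axis j 1 \<in> int_lattice" for j :: 'n
    by (auto simp: int_lattice_def axis_def)
  ultimately have "\<exists>x. x \<in> int_lattice \<and> B *v x = axis j 1" for j
    by blast
  then obtain a :: "'n \<Rightarrow> real ^ 'n" where a: "\<And>j. a j \<in> int_lattice" "\<And>j. B *v a j = axis j 1"
    by metis
  define A :: "real ^ 'n ^ 'n" where "A = transpose (\<chi> j. a j)"
  have A_axis: "A *v axis j 1 = a j" for j
    by (simp add: A_def matrix_vector_mult_basis column_transpose row_def)
  have "(B ** A) *v axis j 1 = mat 1 *v axis j 1" for j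
    by (simp add: matrix_vector_mul_assoc[symmetric] A_axis a)
  then have "column j (B ** A) = column j (mat 1)" for j
    unfolding matrix_vector_mult_basis .
  then have BA: "B ** A = mat 1"
    by (simp add: column_def vec_eq_iff)
  then have AB: "A ** B = mat 1"
    by (simp add: matrix_left_right_inverse)
  have intA: "A $ i $ j \<in> \<int>" for i j
    using a(1)[of j] by (simp add: A_def transpose_def int_lattice_def)
  have "f (\<tau> j) \<in> int_lattice" for j
    using f(1) \<tau> lattice_diffs_int_lattice unfolding transversal_def bij_betw_def by blast
  then have intB: "B $ i $ j \<in> \<int>" for i j
    by (simp add: B_def transpose_def int_lattice_def)
  have "det A \<in> \<int>" "det B \<in> \<int>"
    using det_Ints intA intB by blast+
  then obtain x y where xy: "det A = of_int x" "det B = of_int y"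
    by (elim Ints_cases)
  have "det A * det B = 1"
    using AB det_mul[of A B] by simp
  then have "x * y = 1"
    unfolding xy by (metis of_int_1 of_int_eq_iff of_int_mult)
  then have "\<bar>x\<bar> = 1" "\<bar>y\<bar> = 1"
    using abs_zmult_eq_1[of x y] abs_zmult_eq_1[of y x] by (simp_all add: mult.commute)
  then have "\<bar>det A\<bar> = 1" "\<bar>det B\<bar> = 1"
    unfolding xy by linarith+
  moreover have "A *v (B *v x) = x" "B *v (A *v x) = x" for x
    by (simp_all only: matrix_vector_mul_assoc AB BA matrix_vector_mul_lid)
  ultimately show ?thesis
    using that[of A B] intA intB B by blast
qed

text \<open>In the coordinates of a full transversal, members outside \<open>S\<close> have entries
  at most 1, and those in \<open>S\<close> are controlled by \<open>reach_coeffs_bound\<close>.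
  Reaching them within \<open>Suc CARD('n)\<close> steps gives the exponent
  \<open>CARD('n) + 2\<close>.\<close>

lemma bounded_coordinates:
  assumes "CARD('n) < length Ps"
  obtains A B :: "real ^ 'n ^ 'n" where
    "\<And>i j. A $ i $ j \<in> \<int>" "\<bar>det A\<bar> = 1" "\<And>x. B *v (A *v x) = x"
    "\<And>k d i. k < length Ps \<Longrightarrow> d \<in> D k \<Longrightarrow> \<bar>(A *v d) $ i\<bar> \<le> real CARD('n) ^ (CARD('n) + 2)"
proof -
  obtain e S l where e: "transversal e S" "card S = CARD('n)" "l < length Ps" "l \<notin> S"
    "reach e S l (Suc CARD('n)) = insert l S"
    using exists_full_transversal[OF assms] by metis
  have fin: "finite S"
    using e transversal_finite by blast
  obtain \<tau> :: "'n \<Rightarrow> nat" where \<tau>: "bij_betw \<tau> UNIV S"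
    using finite_same_card_bij[of "UNIV :: 'n set" S] fin e(2) by auto
  obtain A B :: "real ^ 'n ^ 'n" where AB: "\<And>i j. A $ i $ j \<in> \<int>" "\<bar>det A\<bar> = 1"
    "\<And>i j. B $ i $ j \<in> \<int>" "\<bar>det B\<bar> = 1"
    "\<And>x. A *v (B *v x) = x" "\<And>x. B *v (A *v x) = x" "\<And>x. B *v x = (\<Sum>i\<in>UNIV. x $ i *\<^sub>R e (\<tau> i))"
    by (rule transversal_unimodular[OF e(1,2) \<tau>]) (rule that; blast)
  have "\<bar>(A *v d) $ i\<bar> \<le> real CARD('n) ^ (CARD('n) + 2)" if k: "k < length Ps" "d \<in> D k" for k d i
  proof -
    obtain c where c: "d = (\<Sum>i\<in>S. c i *\<^sub>R e i)"
      using in_span_image_finite[OF fin, of d e] transversal_spanning[OF e(1,2)] by auto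
    have "\<tau> i \<in> S"
      using \<tau> bij_betwE by blast
    have "d = B *v (\<chi> i. c (\<tau> i))"
      unfolding AB(7) c using sum.reindex_bij_betw[OF \<tau>, of "\<lambda>i. c i *\<^sub>R e i"] by simp
    then have "(A *v d) $ i = c (\<tau> i)"
      by (simp add: AB(5))
    moreover have "\<bar>c (\<tau> i)\<bar> \<le> real CARD('n) ^ (CARD('n) + 2)"
    proof (cases "k \<in> S")
      case True
      then have "k \<in> reach e S l (Suc CARD('n))"
        unfolding e(5) by simp
      from reach_coeffs_bound[OF e(1-4) this k(2)[unfolded c] \<open>\<tau> i \<in> S\<close>] show ?thesis
        by simp
    next
      case False
      then have "\<bar>c (\<tau> i)\<bar> \<le> 1"
        using transversal_coeffs_bound[OF e(1,2) k(1)] k(2) c \<open>\<tau> i \<in> S\<close> by blast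
      also have "1 \<le> real CARD('n) ^ (CARD('n) + 2)"
        by (intro one_le_power) (simp add: Suc_leI)
      finally show ?thesis .
    qed
    ultimately show ?thesis by simp
  qed
  then show ?thesis
    using that AB by blast
qed

lemma normalized_members:
  assumes "CARD('n) < length Ps"
  obtains A B :: "real ^ 'n ^ 'n" and x where
    "\<And>i j. A $ i $ j \<in> \<int>" "\<bar>det A\<bar> = 1" "\<And>x. B *v (A *v x) = x"
    "\<And>i. i < length Ps \<Longrightarrow> x i \<in> Ps ! i \<inter> int_lattice"
    "\<And>i. i < length Ps \<Longrightarrow>
      (\<lambda>y. A *v (y - x i)) ` (Ps ! i) \<in> box_polytopes (real CARD('n) ^ (CARD('n) + 2))"
proof -
  obtain A B :: "real ^ 'n ^ 'n" where AB: "\<And>i j. A $ i $ j \<in> \<int>" "\<bar>det A\<bar> = 1" "\<And>x. B *v (A *v x) = x"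
    "\<And>k d i. k < length Ps \<Longrightarrow> d \<in> D k \<Longrightarrow> \<bar>(A *v d) $ i\<bar> \<le> real CARD('n) ^ (CARD('n) + 2)"
    by (rule bounded_coordinates[OF assms]) (rule that; blast)
  have "\<exists>x. x \<in> Ps ! i \<inter> int_lattice" if "i < length Ps" for i
    using lattice_polytope_obtain_point lattice_polytope[OF that] by blast
  then obtain x where x: "\<And>i. i < length Ps \<Longrightarrow> x i \<in> Ps ! i \<inter> int_lattice"
    by metis
  have "(\<lambda>y. A *v (y - x i)) ` (Ps ! i) \<in> box_polytopes (real CARD('n) ^ (CARD('n) + 2))"
    if i: "i < length Ps" for i
  proof -
    define Y where "Y = (\<lambda>y. A *v (y - x i)) ` (Ps ! i \<inter> int_lattice)"
    have aff: "(\<lambda>y. A *v (y - x i)) ` Z = (+) (- (A *v x i)) ` ((*v) A ` Z)" for Z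
      by (simp add: image_image matrix_vector_mult_diff_distrib)
    have "(\<lambda>y. A *v (y - x i)) ` (convex hull (Ps ! i \<inter> int_lattice)) = convex hull Y"
      unfolding Y_def aff convex_hull_translation
      by (subst convex_hull_linear_image) simp_all
    then have "(\<lambda>y. A *v (y - x i)) ` (Ps ! i) = convex hull Y"
      using lattice_polytope_eq_hull[OF lattice_polytope[OF i]] by metis
    moreover have "Y \<noteq> {}"
      using x[OF i] by (auto simp: Y_def)
    moreover have "A *v (y - x i) \<in> int_lattice" "\<bar>(A *v (y - x i)) $ j\<bar> \<le> real CARD('n) ^ (CARD('n) + 2)"
      if "y \<in> Ps ! i \<inter> int_lattice" for y j
    proof -
      have "y - x i \<in> D i"
        using that x[OF i] by (auto simp: lattice_diffs_def)
      then show "A *v (y - x i) \<in> int_lattice" "\<bar>(A *v (y - x i)) $ j\<bar> \<le> real CARD('n) ^ (CARD('n) + 2)"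
        using AB(4)[OF i] unimodular_int_lattice_iff[OF AB(1,2)] lattice_diffs_int_lattice by blast+
    qed
    ultimately show ?thesis
      unfolding box_polytopes_def by (intro image_eqI[of _ _ Y]) (auto simp: Y_def)
  qed
  then show ?thesis
    using that AB x by blast
qed

lemma identified_with_box_family:
  assumes "CARD('n) < length Ps"
  obtains Rs where "identified Ps Rs" "length Rs = length Ps"
    "set Rs \<subseteq> box_polytopes (real CARD('n) ^ (CARD('n) + 2))"
proof -
  obtain A B :: "real ^ 'n ^ 'n" and x where AB: "\<And>i j. A $ i $ j \<in> \<int>" "\<bar>det A\<bar> = 1" "\<And>x. B *v (A *v x) = x"
    "\<And>i. i < length Ps \<Longrightarrow> x i \<in> Ps ! i \<inter> int_lattice"
    "\<And>i. i < length Ps \<Longrightarrow>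
      (\<lambda>y. A *v (y - x i)) ` (Ps ! i) \<in> box_polytopes (real CARD('n) ^ (CARD('n) + 2))"
    by (rule normalized_members[OF assms]) (rule that; blast)
  define Rs where "Rs = map (\<lambda>i. (\<lambda>y. A *v (y - x i)) ` (Ps ! i)) [0..<length Ps]"
  have "affine_unimodular (\<lambda>y. A *v y)"
    unfolding affine_unimodular_def using AB(1,2) by (intro exI[of _ A] exI[of _ 0]) auto
  moreover have "lattice_translate (Rs ! i) ((*v) A ` (Ps ! i))" if i: "i < length Ps" for i
  proof -
    have "- (A *v x i) \<in> int_lattice"
      using AB(4)[OF i] unimodular_int_lattice_iff[OF AB(1,2)] int_lattice_diff[of 0 "A *v x i"] by simp
    then show ?thesis
      unfolding lattice_translate_def using i
      by (intro bexI[of _ "- (A *v x i)"]) (simp_all add: Rs_def image_image matrix_vector_mult_diff_distrib)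
  qed
  ultimately have "identified Ps Rs"
    unfolding identified_def using permutes_id by (intro conjI exI[of _ "(*v) A"] exI[of _ id]) (auto simp: Rs_def)
  moreover have "set Rs \<subseteq> box_polytopes (real CARD('n) ^ (CARD('n) + 2))"
    using AB(5) by (auto simp: Rs_def)
  ultimately show ?thesis
    using that[of Rs] by (simp add: Rs_def)
qed

text \<open>Pigeonhole on the normal forms in the box: members with the same normal form differ by
  \<open>x i - x j\<close> because \<open>A\<close> is injective.\<close>

lemma many_translates:
  assumes m: "CARD('n) < length Ps"
    and large: "CARD('n) * card (box_polytopes (real CARD('n) ^ (CARD('n) + 2)) :: (real ^ 'n) set set) < length Ps"
  obtains G i0 where "G \<subseteq> {..<length Ps}" "CARD('n) < card G" "i0 < length Ps"
    "\<And>i. i \<in> G \<Longrightarrow> lattice_translate (Ps ! i) (Ps ! i0)"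
proof -
  obtain A B :: "real ^ 'n ^ 'n" and x where AB: "\<And>i j. A $ i $ j \<in> \<int>" "\<bar>det A\<bar> = 1" "\<And>x. B *v (A *v x) = x"
    "\<And>i. i < length Ps \<Longrightarrow> x i \<in> Ps ! i \<inter> int_lattice"
    "\<And>i. i < length Ps \<Longrightarrow>
      (\<lambda>y. A *v (y - x i)) ` (Ps ! i) \<in> box_polytopes (real CARD('n) ^ (CARD('n) + 2))"
    by (rule normalized_members[OF m]) (rule that; blast)
  define R where "R = (\<lambda>i. (\<lambda>y. A *v (y - x i)) ` (Ps ! i))"
  define \<P> where "\<P> = (box_polytopes (real CARD('n) ^ (CARD('n) + 2)) :: (real ^ 'n) set set)"
  have "\<exists>X\<in>\<P>. CARD('n) < card {i. i < length Ps \<and> R i = X}"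
  proof (rule ccontr)
    assume "\<not> (\<exists>X\<in>\<P>. CARD('n) < card {i. i < length Ps \<and> R i = X})"
    then have le: "card {i. i < length Ps \<and> R i = X} \<le> CARD('n)" if "X \<in> \<P>" for X
      using that by force
    have "{..<length Ps} = (\<Union>X\<in>\<P>. {i. i < length Ps \<and> R i = X})"
      using AB(5) by (auto simp: R_def \<P>_def)
    then have "length Ps \<le> (\<Sum>X\<in>\<P>. card {i. i < length Ps \<and> R i = X})"
      using card_UN_le[of \<P> "\<lambda>X. {i. i < length Ps \<and> R i = X}"] finite_box_polytopes
      by (metis \<P>_def card_lessThan)
    also have "\<dots> \<le> card \<P> * CARD('n)"
      using le by (intro sum_bounded_above[THEN order_trans]) auto
    finally show False
      using large by (simp add: \<P>_def mult.commute)
  qed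
  then obtain X where X: "CARD('n) < card {i. i < length Ps \<and> R i = X}"
    by blast
  define G where "G = {i. i < length Ps \<and> R i = X}"
  have "G \<noteq> {}"
    using X unfolding G_def[symmetric] by auto
  then obtain i0 where i0: "i0 \<in> G"
    by blast
  have A_inj: "y = y'" if "A *v y = A *v y'" for y y'
    using that AB(3) by metis
  have sub: "Ps ! i \<subseteq> (+) (x i - x j) ` (Ps ! j)" if "i \<in> G" "j \<in> G" for i j
  proof
    fix y assume "y \<in> Ps ! i"
    then have "A *v (y - x i) \<in> R j"
      using that by (auto simp: G_def R_def)
    then obtain y' where "y' \<in> Ps ! j" "A *v (y - x i) = A *v (y' - x j)"
      by (auto simp: R_def)
    then show "y \<in> (+) (x i - x j) ` (Ps ! j)"
      using A_inj[of "y - x i" "y' - x j"] by (intro image_eqI[of _ _ y']) (auto simp: algebra_simps)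
  qed
  have "lattice_translate (Ps ! i) (Ps ! i0)" if i: "i \<in> G" for i
  proof -
    have "(+) (x i - x i0) ` (Ps ! i0) \<subseteq> Ps ! i"
      using image_mono[OF sub[OF i0 i], of "(+) (x i - x i0)"] by (simp add: image_image)
    then have "Ps ! i = (+) (x i - x i0) ` (Ps ! i0)"
      using sub[OF i i0] by auto
    moreover have "x i - x i0 \<in> int_lattice"
      using AB(4) i i0 by (intro int_lattice_diff) (auto simp: G_def)
    ultimately show ?thesis
      unfolding lattice_translate_def by blast
  qed
  then show ?thesis
    using that[of G i0] X i0 by (auto simp: G_def)
qed

text \<open>Suppose \<open>Suc j\<close> members are translates of \<open>F\<close>. A lattice point
  of one of them starts \<open>growth\<close>, and the other \<open>j\<close> carry a basis of the
  common direction space; since \<open>Suc j \<le> CARD('n)\<close>, this contradicts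
  hollowness.\<close>

lemma card_translates_le:
  assumes "aff_dim F = int j" "j < CARD('n)"
  shows "card {i. i < length Ps \<and> lattice_translate (Ps ! i) F} \<le> j"
proof (rule ccontr)
  assume "\<not> ?thesis"
  then have "Suc j \<le> card {i. i < length Ps \<and> lattice_translate (Ps ! i) F}"
    by simp
  then obtain G where G: "G \<subseteq> {i. i < length Ps \<and> lattice_translate (Ps ! i) F}" "card G = Suc j"
    by (rule obtain_subset_with_card_n)
  then have "finite G" "G \<noteq> {}"
    using card.infinite[of G] by (fastforce, auto)
  then obtain i0 where i0: "i0 \<in> G"
    by blast
  have D_eq: "D i = D i0" if "i \<in> G" for i
    using that i0 G(1) lattice_translate_lattice_diffs by blast
  have lp: "lattice_polytope (Ps ! i0)"
    using i0 G(1) lattice_polytope by auto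
  obtain x0 where x0: "x0 \<in> Ps ! i0" "x0 \<in> int_lattice"
    using lattice_polytope_obtain_point[OF lp] .
  obtain B where B: "B \<subseteq> (\<lambda>x. x - x0) ` (Ps ! i0 \<inter> int_lattice)" "independent B"
    "D i0 \<subseteq> span B" "int (card B) = aff_dim (Ps ! i0)"
    using lattice_polytope_diff_basis[OF lp, of x0] x0 by blast
  have "aff_dim (Ps ! i0) = int j"
    using i0 G(1) assms(1) lattice_translate_aff_dim[of "Ps ! i0" F] by auto
  then have "card B = card (G - {i0})"
    using B(4) G(2) i0 by simp
  moreover have "finite B"
    using B(2) independent_bound by blast
  ultimately obtain f where f: "bij_betw f (G - {i0}) B"
    using finite_same_card_bij \<open>finite G\<close> by (metis finite_Diff)
  have "B \<subseteq> D i0"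
    using B(1) x0 unfolding lattice_diffs_def by blast
  show False
  proof (rule growth[of "G - {i0}" f "{i0}" "\<lambda>_. x0"])
    show "G - {i0} \<subseteq> {..<length Ps}" "{i0} \<subseteq> {..<length Ps}"
      using G i0 by auto
    have fB: "f ` (G - {i0}) = B"
      using f by (simp add: bij_betw_def)
    then show "f i \<in> D i" if "i \<in> G - {i0}" for i
      using that \<open>B \<subseteq> D i0\<close> D_eq by blast
    have "G - {i0} \<union> {i0} = G"
      using i0 by blast
    then show "card (G - {i0} \<union> {i0}) \<le> CARD('n)" 
      "\<And>i. i \<in> G - {i0} \<union> {i0} \<Longrightarrow> D i \<subseteq> span (f ` (G - {i0}))"
      using G(2) assms(2) fB B(3) D_eq by auto
  qed (use x0 in auto)
qed

end

section \<open>Many translates of one polytope\<close>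

lemma Basis_cart: "Basis = range (\<lambda>i. axis i 1 :: real ^ 'n::finite)"
  by (auto simp: Basis_vec_def)

lemma std_simplex_cart:
  "convex hull (insert 0 Basis) = {x :: real ^ 'n::finite. (\<forall>i. 0 \<le> x $ i) \<and> (\<Sum>i\<in>UNIV. x $ i) \<le> 1}"
proof -
  have "(\<Sum>b\<in>Basis. x \<bullet> b) = (\<Sum>i\<in>UNIV. x $ i)" for x :: "real ^ 'n"
    unfolding Basis_cart by (subst sum.reindex) (auto simp: inj_on_def axis_eq_axis inner_axis)
  moreover have "(\<forall>b\<in>Basis. 0 \<le> x \<bullet> b) \<longleftrightarrow> (\<forall>i. 0 \<le> x $ i)" for x :: "real ^ 'n"
    unfolding Basis_cart by (auto simp: inner_axis)
  ultimately show ?thesis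
    unfolding std_simplex by simp
qed

context hollow_family
begin

text \<open>So many members share the differences \<open>E\<close> that a basis from
  \<open>E\<close> can be assigned to distinct members other than \<open>l\<close>; then
  \<open>transversal_coeffs_bound\<close> applies to \<open>l\<close>, even when \<open>l\<close> is
  in \<open>G\<close>.\<close>

lemma full_family_coeffs_bound:
  fixes g :: "'n \<Rightarrow> real ^ 'n"
  assumes G: "G \<subseteq> {..<length Ps}" "CARD('n) < card G" "\<And>i. i \<in> G \<Longrightarrow> D i = E"
    and g: "\<And>i. g i \<in> E" "span (range g) = UNIV"
    and l: "l < length Ps" "(\<Sum>i\<in>UNIV. c i *\<^sub>R g i) \<in> D l"
  shows "\<bar>c i\<bar> \<le> 1"
proof -
  have "finite G"
    using G(1) finite_subset by blast
  then have "CARD('n) \<le> card (G - {l})"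
    using G(2) card_Diff1_le[of G l] by (cases "l \<in> G") auto
  then obtain \<tau> :: "'n \<Rightarrow> nat" where \<tau>: "range \<tau> \<subseteq> G - {l}" "inj \<tau>"
    using card_le_inj[of "UNIV :: 'n set" "G - {l}"] \<open>finite G\<close> by auto
  define f where "f = g \<circ> inv \<tau>"
  have f_\<tau>: "f (\<tau> i) = g i" for i
    using \<tau>(2) by (simp add: f_def)
  then have "f ` range \<tau> = range g"
    by (metis comp_apply image_cong image_image)
  moreover have card: "card (range \<tau>) = CARD('n)"
    using \<tau>(2) by (simp add: card_image)
  ultimately have "inj_on f (range \<tau>)" "independent (f ` range \<tau>)"
    using spanning_family_independent[of "range \<tau>" f] g(2) by auto
  moreover have "f (\<tau> i) \<in> D (\<tau> i)" for i
  proof -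
    have "\<tau> i \<in> G"
      using \<tau>(1) by blast
    then show ?thesis
      using f_\<tau> g(1) G(3) by simp
  qed
  ultimately have tr: "transversal f (range \<tau>)"
    using \<tau>(1) G(1) by (auto simp: transversal_def)
  have "(\<Sum>s\<in>range \<tau>. c (inv \<tau> s) *\<^sub>R f s) = (\<Sum>i\<in>UNIV. c i *\<^sub>R g i)"
    using \<tau>(2) by (simp add: sum.reindex f_\<tau>)
  then have "\<bar>c (inv \<tau> (\<tau> i))\<bar> \<le> 1"
    using transversal_coeffs_bound[OF tr card l(1), of "c \<circ> inv \<tau>" "\<tau> i"] \<tau>(1) l(2) by auto
  then show ?thesis
    using \<tau>(2) by simp
qed

end

text \<open>The points \<open>v0\<close> and \<open>v0 + \<beta> i\<close> span a simplex inside
  \<open>F\<close>. \<open>B\<close> has its edge vectors as columns and \<open>A\<close> is the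
  inverse; integrality of both makes the simplex unimodular.\<close>

locale simplex_copies = hollow_family Ps for Ps :: "(real ^ 'n::finite) set list" +
  fixes G :: "nat set" and F :: "(real ^ 'n) set" and v0 :: "real ^ 'n" and \<beta> :: "'n \<Rightarrow> real ^ 'n"
    and A B :: "real ^ 'n ^ 'n"
  assumes G: "G \<subseteq> {..<length Ps}" "CARD('n) < card G"
    and copies: "\<And>i. i \<in> G \<Longrightarrow> lattice_translate (Ps ! i) F"
    and v0: "v0 \<in> F \<inter> int_lattice" and v: "\<And>i. v0 + \<beta> i \<in> F \<inter> int_lattice"
    and intA: "\<And>i j. A $ i $ j \<in> \<int>" and detA: "\<bar>det A\<bar> = 1"
    and intB: "\<And>i j. B $ i $ j \<in> \<int>" and detB: "\<bar>det B\<bar> = 1"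
    and BA: "\<And>x. B *v (A *v x) = x" and B: "\<And>x. B *v x = (\<Sum>i\<in>UNIV. x $ i *\<^sub>R \<beta> i)"
begin

definition vertex :: "'n option \<Rightarrow> real ^ 'n" where
  "vertex a = (case a of None \<Rightarrow> v0 | Some i \<Rightarrow> v0 + \<beta> i)"

text \<open>Barycentric coordinates of directions, where \<^const>\<open>None\<close> stands for the vertex \<open>v0\<close>.\<close>

definition bary :: "'n option \<Rightarrow> real ^ 'n \<Rightarrow> real" where
  "bary a d = (case a of None \<Rightarrow> - (\<Sum>i\<in>UNIV. (A *v d) $ i) | Some i \<Rightarrow> (A *v d) $ i)"

lemma bary_diff: "bary a (x - y) = bary a x - bary a y"
  by (cases a) (simp_all add: bary_def matrix_vector_mult_diff_distrib sum_subtractf)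

lemma sum_bary: "(\<Sum>a\<in>UNIV. bary a d) = 0"
  by (simp add: sum_UNIV_option bary_def)

lemma bary_expansion: "d = (\<Sum>i\<in>UNIV. bary (Some i) d *\<^sub>R \<beta> i)"
  using BA[of d] B[of "A *v d"] by (simp add: bary_def)

text \<open>Barycentric coordinates of a direction sum to zero, so any constant \<open>M\<close> may
  be subtracted. Taking \<open>M\<close> to be the maximum of \<open>u\<close> on the vertices later
  controls the signs.\<close>

lemma inner_bary: "u \<bullet> d = (\<Sum>a\<in>UNIV. bary a d * (u \<bullet> vertex a - M))"
proof -
  have "(\<Sum>a\<in>UNIV. bary a d * (u \<bullet> vertex a - M)) = (\<Sum>a\<in>UNIV. bary a d * (u \<bullet> vertex a)) - M * (\<Sum>a\<in>UNIV. bary a d)"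
    by (simp add: right_diff_distrib sum_subtractf sum_distrib_left mult.commute)
  also have "\<dots> = (\<Sum>a\<in>UNIV. bary a d * (u \<bullet> vertex a)) - (u \<bullet> v0) * (\<Sum>a\<in>UNIV. bary a d)"
    by (simp add: sum_bary)
  also have "\<dots> = (\<Sum>a\<in>UNIV. bary a d * (u \<bullet> vertex a - u \<bullet> v0))"
    by (simp add: right_diff_distrib sum_subtractf sum_distrib_left mult.commute)
  also have "\<dots> = u \<bullet> (\<Sum>i\<in>UNIV. bary (Some i) d *\<^sub>R \<beta> i)"
    by (simp add: sum_UNIV_option vertex_def inner_sum_right inner_add_right)
  finally show ?thesis
    using bary_expansion[of d] by simp
qed

lemma bary_Ints: "d \<in> int_lattice \<Longrightarrow> bary a d \<in> \<int>"
  using unimodular_int_lattice_iff[OF intA detA, of d]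
  by (cases a) (auto simp: bary_def int_lattice_def intro!: Ints_sum)

lemma vertex_mem: "vertex a \<in> F \<inter> int_lattice"
  using v0 v by (cases a) (auto simp: vertex_def)

lemma vertex_diff: "vertex a - vertex b \<in> lattice_diffs F"
  using vertex_mem by (auto simp: lattice_diffs_def)

lemma D_copies: "i \<in> G \<Longrightarrow> D i = lattice_diffs F"
  using copies lattice_translate_lattice_diffs by blast

lemma span_\<beta>: "span (range \<beta>) = UNIV"
  using sum_in_span_image[of "\<lambda>i. bary (Some i) _" \<beta> UNIV] bary_expansion by (metis UNIV_eq_I)

lemma bary_bound:
  assumes l: "l < length Ps" "d \<in> D l"
  shows "\<bar>bary a d\<bar> \<le> 1"
proof (cases a)
  case (Some i)
  have "\<beta> i \<in> lattice_diffs F" for i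
    using vertex_diff[of "Some i" None] by (simp add: vertex_def)
  then show ?thesis
    using full_family_coeffs_bound[OF G D_copies _ span_\<beta> l(1), of "\<lambda>i. bary (Some i) d" i] l(2)
      bary_expansion[of d] Some by simp
next
  case None
  fix k :: 'n
  \<comment> \<open>The coordinate at \<open>None\<close> is not a coordinate in the basis
    \<open>\<beta>\<close>. Edges at the vertex \<open>Some k\<close>, up to sign, form a basis in
    which \<open>\<beta> k\<close> has as coefficient the sum of all \<open>Some\<close>
    coordinates, which is minus the coordinate at \<open>None\<close>.\<close>
  define g where "g = (\<lambda>i. if i = k then \<beta> k else \<beta> i - \<beta> k)"
  define c where "c = (\<lambda>i. if i = k then \<Sum>i\<in>UNIV. bary (Some i) d else bary (Some i) d)"
  have g: "g i \<in> lattice_diffs F" for i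
    using vertex_diff[of "Some i" None] vertex_diff[of "Some i" "Some k"] by (auto simp: vertex_def g_def)
  have "\<beta> i \<in> span (range g)" for i
  proof -
    have "g i + g k \<in> span (range g)" "g k \<in> span (range g)"
      by (intro span_add span_base rangeI)+
    then show ?thesis
      by (cases "i = k") (simp_all add: g_def)
  qed
  then have "span (range g) = UNIV"
    using span_minimal[of "range \<beta>" "span (range g)"] span_\<beta> by auto
  moreover have "(\<Sum>i\<in>UNIV. c i *\<^sub>R g i) = d"
  proof -
    have "(\<Sum>i\<in>UNIV. c i *\<^sub>R g i) = c k *\<^sub>R g k + (\<Sum>i\<in>UNIV - {k}. c i *\<^sub>R g i)"
      by (simp add: sum.remove)
    also have "(\<Sum>i\<in>UNIV - {k}. c i *\<^sub>R g i) = (\<Sum>i\<in>UNIV - {k}. bary (Some i) d *\<^sub>R (\<beta> i - \<beta> k))"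
      by (intro sum.cong) (auto simp: c_def g_def)
    also have "\<dots> = (\<Sum>i\<in>UNIV. bary (Some i) d *\<^sub>R (\<beta> i - \<beta> k))"
      by (intro sum.mono_neutral_left) auto
    also have "\<dots> = d - (\<Sum>i\<in>UNIV. bary (Some i) d) *\<^sub>R \<beta> k"
      using bary_expansion[of d] by (simp add: scaleR_diff_right sum_subtractf scaleR_sum_left)
    finally show ?thesis
      by (simp add: c_def g_def)
  qed
  ultimately have "\<bar>c k\<bar> \<le> 1"
    using full_family_coeffs_bound[where c = c and i = k, OF G D_copies g _ l(1)] l(2) by simp
  moreover have "c k = - bary None d"
    using sum_bary[of d] by (simp add: c_def sum_UNIV_option)
  ultimately show ?thesis
    using None by simp
qed

text \<open>The point \<open>p\<close> plus one vertex of \<open>F\<close> for every index besides \<open>a\<close> and \<open>b\<close> would be an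
  interior lattice point of the sum of \<open>Ps ! l\<close> and \<open>CARD('n) - 1\<close> translates of \<open>F\<close>.\<close>

lemma no_interior_corner:
  assumes l: "l < length Ps" "p \<in> Ps ! l \<inter> int_lattice" "p1 \<in> Ps ! l" "p2 \<in> Ps ! l" and "a \<noteq> b"
    and p1: "bary a (p1 - p) = -1" "bary b (p1 - p) \<le> 0"
    and p2: "bary b (p2 - p) = -1" "bary a (p2 - p) \<le> 0"
  shows False
proof -
  define T where "T = UNIV - {a, b}"
  have UNIV_T: "sum h UNIV = h a + (h b + sum h T)" for h :: "'n option \<Rightarrow> real"
    using \<open>a \<noteq> b\<close> by (simp add: T_def sum.remove[of UNIV a] sum.remove[of "UNIV - {a}" b] Diff_insert2[symmetric])
  \<comment> \<open>If \<open>a\<close> and \<open>b\<close> were the only indices, the coordinates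
    of \<open>p1 - p\<close> would sum to at most -1 instead of 0.\<close>
  have "T \<noteq> {}"
    using sum_bary[of "p1 - p"] p1 by (auto simp: UNIV_T)
  then obtain c where c: "c \<in> T"
    by blast
  have cardT: "Suc (card T) = CARD('n)"
    using \<open>a \<noteq> b\<close> by (simp add: T_def card_Diff_subset card_UNIV_option)
  have "finite G"
    using G(1) finite_subset by blast
  then have "card T \<le> card (G - {l})"
    using G(2) cardT card_Diff1_le[of G l] by (cases "l \<in> G") auto
  then obtain \<tau> where \<tau>: "\<tau> ` T \<subseteq> G - {l}" "inj_on \<tau> T"
    using card_le_inj[of T "G - {l}"] \<open>finite G\<close> by (auto simp: T_def)
  have "\<exists>t. t \<in> int_lattice \<and> Ps ! i = (+) t ` F" if "i \<in> G" for i
    using copies[OF that] by (auto simp: lattice_translate_def)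
  then obtain t where t: "\<And>i. i \<in> G \<Longrightarrow> t i \<in> int_lattice" "\<And>i. i \<in> G \<Longrightarrow> Ps ! i = (+) (t i) ` F"
    by metis
  define h where "h = (\<lambda>i. if i = l then p else t i + vertex (the_inv_into T \<tau> i))"
  have h_\<tau>: "h (\<tau> o') = t (\<tau> o') + vertex o'" if "o' \<in> T" for o'
    using that \<tau> by (auto simp: h_def the_inv_into_f_f)
  have \<tau>G: "\<tau> o' \<in> G" if "o' \<in> T" for o'
    using that \<tau> by auto
  have lT: "l \<notin> \<tau> ` T"
    using \<tau> by auto
  show False
  proof (rule hollowD[of "insert l (\<tau> ` T)" h])
    show "insert l (\<tau> ` T) \<noteq> {}" by simp
    show "insert l (\<tau> ` T) \<subseteq> {..<length Ps}"
      using l \<tau> G by auto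
    show "card (insert l (\<tau> ` T)) \<le> CARD('n)"
      using cardT lT \<tau>(2) by (simp add: T_def card_image)
    show "h i \<in> Ps ! i" if "i \<in> insert l (\<tau> ` T)" for i
    proof (cases "i = l")
      case False
      then obtain o' where "o' \<in> T" "i = \<tau> o'"
        using \<open>i \<in> insert l (\<tau> ` T)\<close> by auto
      then show ?thesis
        using h_\<tau> t(2)[OF \<tau>G] vertex_mem by auto
    qed (use l in \<open>simp add: h_def\<close>)
    have "h i \<in> int_lattice" if i: "i \<in> insert l (\<tau> ` T)" for i
    proof (cases "i = l")
      case False
      then obtain o' where "o' \<in> T" "i = \<tau> o'"
        using i by auto
      then show ?thesis
        using h_\<tau> t(1)[OF \<tau>G] vertex_mem by (auto intro: int_lattice_add)
    qed (use l in \<open>simp add: h_def\<close>)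
    then show "sum h (insert l (\<tau> ` T)) \<in> int_lattice"
      by (rule int_lattice_sum)
    fix u i y
    assume u: "\<And>i y. i \<in> insert l (\<tau> ` T) \<Longrightarrow> y \<in> Ps ! i \<Longrightarrow> u \<bullet> y \<le> u \<bullet> h i"
    have max: "u \<bullet> vertex a' \<le> u \<bullet> vertex o'" if "o' \<in> T" for a' o'
    proof -
      have "t (\<tau> o') + vertex a' \<in> Ps ! \<tau> o'"
        using t(2)[OF \<tau>G[OF that]] vertex_mem by auto
      then have "u \<bullet> (t (\<tau> o') + vertex a') \<le> u \<bullet> h (\<tau> o')"
        using u that by auto
      then show ?thesis
        using h_\<tau>[OF that] by (simp add: inner_add_right)
    qed
    \<comment> \<open>\<open>M\<close> is the maximum of \<open>u\<close> on the vertices, attained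
      at every vertex indexed by \<open>T\<close>, so only \<open>a\<close> and \<open>b\<close>
      contribute to \<open>inner_bary\<close>.\<close>
    define M where "M = u \<bullet> vertex c"
    have le: "u \<bullet> vertex a' \<le> M" for a'
      using max[OF c] by (simp add: M_def)
    have eq: "u \<bullet> vertex o' = M" if "o' \<in> T" for o'
      using max[OF that, of c] le[of o'] by (simp add: M_def)
    have inner: "u \<bullet> d = bary a d * (u \<bullet> vertex a - M) + bary b d * (u \<bullet> vertex b - M)" for d
      using inner_bary[of u d M] eq by (simp add: UNIV_T)
    have "u \<bullet> (p1 - p) \<le> 0" "u \<bullet> (p2 - p) \<le> 0"
      using u[of l p1] u[of l p2] l by (auto simp: h_def inner_diff_right)
    moreover have "0 \<le> bary b (p1 - p) * (u \<bullet> vertex b - M)" "0 \<le> bary a (p2 - p) * (u \<bullet> vertex a - M)"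
      using p1(2) p2(2) le by (intro mult_nonpos_nonpos; simp)+
    \<comment> \<open>The coordinate -1 of \<open>p1 - p\<close> at \<open>a\<close> forces
      \<open>u\<close> up to \<open>M\<close> there, as the contribution of \<open>b\<close> is
      nonnegative; \<open>p2\<close> does the same for \<open>b\<close>. So \<open>u\<close> is
      constant on the vertices, hence zero.\<close>
    ultimately have "M \<le> u \<bullet> vertex a" "M \<le> u \<bullet> vertex b"
      using inner[of "p1 - p"] inner[of "p2 - p"] p1(1) p2(1) by simp_all
    then have "u \<bullet> d = 0" for d
      using inner[of d] le[of a] le[of b] by simp
    then show "u \<bullet> y = u \<bullet> h i"
      by simp
  qed
qed

text \<open>Measured from their minima over the lattice points of the member, all barycentric
  coordinates are 0 or 1 by \<open>bary_bound\<close> and integrality, and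
  \<open>no_interior_corner\<close> forbids two of them to be 1 at the same point.\<close>

lemma member_in_simplex_translate:
  assumes l: "l < length Ps"
  shows "\<exists>t\<in>int_lattice. Ps ! l \<subseteq> (+) t ` ((*v) B ` (convex hull (insert 0 Basis)))"
proof -
  define X where "X = Ps ! l \<inter> int_lattice"
  obtain q where q: "q \<in> X"
    using lattice_polytope_obtain_point lattice_polytope[OF l] unfolding X_def by blast
  have XD: "x - y \<in> D l" if "x \<in> X" "y \<in> X" for x y
    using that by (auto simp: X_def lattice_diffs_def)
  have X_Ints: "bary a (x - y) \<in> \<int>" "\<bar>bary a (x - y)\<bar> \<le> 1" if "x \<in> X" "y \<in> X" for x y a
    using XD[OF that] bary_Ints lattice_diffs_int_lattice bary_bound[OF l] by blast+
  have "\<exists>r\<in>X. \<forall>x\<in>X. bary a (r - q) \<le> bary a (x - q)" for a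
  proof -
    have "finite ((\<lambda>x. bary a (x - q)) ` X)"
      using X_Ints[OF _ q] by (intro finite_subset[OF _ finite_abs_int_segment[of 1]]) auto
    then have "Min ((\<lambda>x. bary a (x - q)) ` X) \<in> (\<lambda>x. bary a (x - q)) ` X"
      using q by (intro Min_in) auto
    then obtain r where "r \<in> X" "Min ((\<lambda>x. bary a (x - q)) ` X) = bary a (r - q)"
      by blast
    then show ?thesis
      using \<open>finite _\<close> by (intro bexI[of _ r]) (auto simp flip: \<open>Min _ = _\<close>)
  qed
  then obtain r where r: "\<And>a. r a \<in> X" "\<And>a x. x \<in> X \<Longrightarrow> bary a (r a - q) \<le> bary a (x - q)"
    by metis
  have height: "bary a (x - r a) = 0 \<or> bary a (x - r a) = 1" if "x \<in> X" for a x
  proof -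
    have "0 \<le> bary a (x - r a)"
      using r(2)[OF that, of a] by (simp add: bary_diff)
    then show ?thesis
      using X_Ints[OF that r(1), of a a] by (elim Ints_cases) auto
  qed
  have unique: "a = b" if x: "x \<in> X" "bary a (x - r a) = 1" "bary b (x - r b) = 1" for x a b
  proof (rule ccontr)
    assume "a \<noteq> b"
    show False
    proof (rule no_interior_corner[OF l _ _ _ \<open>a \<noteq> b\<close>, of x "r a" "r b"])
      show "bary a (r a - x) = -1" "bary b (r b - x) = -1"
        using x by (simp_all add: bary_diff)
      \<comment> \<open>At \<open>x\<close> the coordinate \<open>b\<close> exceeds its minimum by
        1, the largest possible amount, so it cannot increase on passing to \<open>r a\<close>;
        likewise with \<open>a\<close> and \<open>b\<close> exchanged.\<close>
      show "bary b (r a - x) \<le> 0" "bary a (r b - x) \<le> 0"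
        using x height[OF r(1), of a b] height[OF r(1), of b a] by (auto simp: bary_diff)
    qed (use x r(1) in \<open>auto simp: X_def\<close>)
  qed
  \<comment> \<open>Relative to \<open>q\<close>, the coordinates of \<open>t\<close> at all indices
    \<open>Some i\<close> are the minima; \<open>t\<close> need not lie in \<open>X\<close>.\<close>
  define t where "t = q + B *v (\<chi> i. bary (Some i) (r (Some i) - q))"
  have "(\<chi> i. bary (Some i) (r (Some i) - q)) \<in> int_lattice"
    using X_Ints(1)[OF r(1) q] by (simp add: int_lattice_def)
  then have "t \<in> int_lattice"
    using q unimodular_int_lattice_iff[OF intB detB] by (simp add: t_def X_def int_lattice_add)
  moreover have "X \<subseteq> (+) t ` ((*v) B ` (convex hull (insert 0 Basis)))"
  proof
    fix x assume x: "x \<in> X"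
    define y :: "real ^ 'n" where "y = (\<chi> i. bary (Some i) (x - r (Some i)))"
    have "y = (\<chi> i. bary (Some i) (x - q)) - (\<chi> i. bary (Some i) (r (Some i) - q))"
      by (simp add: y_def vec_eq_iff bary_diff)
    then have "B *v y = B *v (\<chi> i. bary (Some i) (x - q)) - B *v (\<chi> i. bary (Some i) (r (Some i) - q))"
      by (simp only: matrix_vector_mult_diff_distrib)
    also have "B *v (\<chi> i. bary (Some i) (x - q)) = x - q"
      using bary_expansion[of "x - q"] by (simp add: B)
    finally have "x = t + B *v y"
      by (simp add: t_def)
    moreover have "(\<Sum>i\<in>UNIV. y $ i) \<le> 1"
    proof (cases "\<exists>k. y $ k = 1")
      case True
      then obtain k where k: "y $ k = 1"
        by blast
      then have "y $ i = 0" if "i \<noteq> k" for i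
        using height[OF x, of "Some i"] unique[OF x, of "Some i" "Some k"] that by (auto simp: y_def)
      then have "(\<Sum>i\<in>UNIV. y $ i) = (\<Sum>i\<in>{k}. y $ i)"
        by (intro sum.mono_neutral_right) auto
      then show ?thesis
        using k by simp
    next
      case False
      then have "y $ i = 0" for i
        using height[OF x, of "Some i"] by (auto simp: y_def)
      then show ?thesis by simp
    qed
    moreover have "0 \<le> y $ i" for i
      using height[OF x, of "Some i"] by (auto simp: y_def)
    ultimately show "x \<in> (+) t ` ((*v) B ` (convex hull (insert 0 Basis)))"
      unfolding std_simplex_cart by blast
  qed
  then have "convex hull X \<subseteq> (+) t ` ((*v) B ` (convex hull (insert 0 Basis)))"
    by (intro hull_minimal convex_translation convex_linear_image) auto
  ultimately show ?thesis
    using lattice_polytope_eq_hull[OF lattice_polytope[OF l]] unfolding X_def by metis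
qed

end

section \<open>Faces of a unimodular simplex\<close>

text \<open>Complementation pairs the subsets, and each pair has \<open>card W\<close> elements in
  total.\<close>

lemma sum_card_Pow:
  assumes "finite W"
  shows "2 * (\<Sum>V\<in>Pow W. card V) = card W * 2 ^ card W"
proof -
  have "(\<Sum>V\<in>Pow W. card V) = (\<Sum>V\<in>Pow W. card (W - V))"
    by (rule sum.reindex_bij_witness[of _ "\<lambda>V. W - V" "\<lambda>V. W - V"]) (auto simp: double_diff)
  then have "2 * (\<Sum>V\<in>Pow W. card V) = (\<Sum>V\<in>Pow W. card V + card (W - V))"
    by (simp add: sum.distrib)
  also have "\<dots> = (\<Sum>V\<in>Pow W. card W)"
    using assms by (intro sum.cong) (auto simp: card_Diff_subset finite_subset card_mono)
  also have "\<dots> = card W * 2 ^ card W"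
    using assms by (simp add: card_Pow)
  finally show ?thesis .
qed

text \<open>This adds up the dimensions of the proper nonempty faces of an \<open>n\<close>-simplex
  with vertex set \<open>W\<close>.\<close>

lemma sum_card_minus_one_proper_subsets:
  assumes "finite W" "card W = Suc n" "1 \<le> n"
  shows "(\<Sum>V\<in>Pow W - {{}, W}. card V - 1) = (2 ^ n - 1) * (n - 1)"
proof -
  have "W \<noteq> {}"
    using assms by auto
  have fin: "finite V" if "V \<in> Pow W" for V
    using that assms(1) finite_subset by auto
  \<comment> \<open>Over the integers the empty set contributes -1, where truncated subtraction
    would give 0; the full set contributes \<open>n\<close>.\<close>
  have "(\<Sum>V\<in>Pow W. int (card V) - 1) =
      (int (card W) - 1) + ((\<Sum>V\<in>Pow W - {W} - {{}}. int (card V) - 1) - 1)"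
    using assms(1) \<open>W \<noteq> {}\<close> by (simp add: sum.remove[of "Pow W" W] sum.remove[of "Pow W - {W}" "{}"])
  moreover have "Pow W - {W} - {{}} = Pow W - {{}, W}"
    by auto
  moreover have "(\<Sum>V\<in>Pow W - {{}, W}. int (card V) - 1) = int (\<Sum>V\<in>Pow W - {{}, W}. card V - 1)"
  proof -
    have "1 \<le> card V" if "V \<in> Pow W - {{}, W}" for V
      using that fin[of V] by (auto simp: Suc_le_eq card_gt_0_iff)
    then show ?thesis
      unfolding of_nat_sum by (intro sum.cong) (auto simp: of_nat_diff)
  qed
  moreover have "(\<Sum>V\<in>Pow W. int (card V) - 1) = int (\<Sum>V\<in>Pow W. card V) - 2 ^ Suc n"
    using assms by (simp add: sum_subtractf card_Pow)
  moreover have "(\<Sum>V\<in>Pow W. card V) = Suc n * 2 ^ n"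
    using sum_card_Pow[OF assms(1)] assms(2) by simp
  ultimately have "int (\<Sum>V\<in>Pow W - {{}, W}. card V - 1) = int (Suc n) * 2 ^ n - 2 ^ Suc n - int n + 1"
    using assms(2) by (simp add: algebra_simps)
  also have "\<dots> = (2 ^ n - 1) * (int n - 1)"
    by (simp add: algebra_simps)
  also have "\<dots> = int ((2 ^ n - 1) * (n - 1))"
    using assms(3) by (simp add: of_nat_diff)
  finally show ?thesis
    by linarith
qed

lemma std_simplex_int_lattice:
  "convex hull (insert 0 Basis) \<inter> int_lattice = (insert 0 Basis :: (real ^ 'n::finite) set)"
proof
  show "insert 0 Basis \<subseteq> convex hull (insert 0 Basis) \<inter> (int_lattice :: (real ^ 'n) set)"
    unfolding Basis_cart by (auto simp: int_lattice_def axis_def intro!: hull_inc)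
next
  show "convex hull (insert 0 Basis) \<inter> int_lattice \<subseteq> (insert 0 Basis :: (real ^ 'n) set)"
  proof
    fix x :: "real ^ 'n"
    assume "x \<in> convex hull (insert 0 Basis) \<inter> int_lattice"
    then have x: "\<And>i. 0 \<le> x $ i" "(\<Sum>i\<in>UNIV. x $ i) \<le> 1" "\<And>i. x $ i \<in> \<int>"
      by (auto simp: std_simplex_cart int_lattice_def)
    show "x \<in> insert 0 Basis"
    proof (cases "x = 0")
      case False
      then obtain k where "x $ k \<noteq> 0"
        by (auto simp: vec_eq_iff)
      then have k: "1 \<le> x $ k"
        using x(1,3)[of k] by (elim Ints_cases) auto
      have rest: "x $ k + (\<Sum>i\<in>UNIV - {k}. x $ i) \<le> 1"
        using x(2) by (simp add: sum.remove[of UNIV k])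
      have ge: "0 \<le> (\<Sum>i\<in>UNIV - {k}. x $ i)"
        using x(1) by (intro sum_nonneg) auto
      have "x $ k = 1" "(\<Sum>i\<in>UNIV - {k}. x $ i) = 0"
        using k rest ge by linarith+
      then have "x = axis k 1"
        using x(1) by (auto simp: vec_eq_iff axis_def sum_nonneg_eq_0_iff)
      then show ?thesis
        by (simp add: Basis_cart)
    qed simp
  qed
qed

lemma unimodular_simplex_vertices:
  fixes Q :: "(real ^ 'n::finite) set"
  assumes "unimodular_simplex Q"
  obtains W where "Q = convex hull W" "finite W" "card W = Suc CARD('n)" "\<not> affine_dependent W"
    "Q \<inter> int_lattice = W"
proof -
  obtain \<phi> where \<phi>: "affine_unimodular \<phi>" "Q = \<phi> ` (convex hull (insert 0 Basis))"
    using assms unfolding unimodular_simplex_def by blast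
  then obtain A :: "real ^ 'n ^ 'n" and b where A: "\<bar>det A\<bar> = 1" "\<phi> = (\<lambda>x. A *v x + b)"
    unfolding affine_unimodular_def by blast
  define E :: "(real ^ 'n) set" where "E = insert 0 Basis"
  define W where "W = \<phi> ` E"
  have "invertible A"
    using A(1) by (auto simp: invertible_det_nz)
  then have inj: "inj ((*v) A)"
    by (rule inj_matrix_vector_mult)
  have \<phi>_eq: "\<phi> ` Z = (+) b ` ((*v) A ` Z)" for Z
    unfolding A(2) by (auto simp: image_image add.commute)
  have hull: "Q = convex hull W"
    unfolding \<phi>(2) W_def \<phi>_eq convex_hull_translation E_def by (subst convex_hull_linear_image) simp_all
  have "inj \<phi>"
    using inj unfolding A(2) inj_def by simp
  moreover have cardE: "finite E" "card E = Suc CARD('n)"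
    by (simp_all add: E_def)
  ultimately have W: "finite W" "card W = Suc CARD('n)"
    by (auto simp: W_def card_image inj_on_subset)
  have "aff_dim W = aff_dim E"
    unfolding W_def \<phi>_eq aff_dim_translation_eq using inj by simp
  also have "\<dots> = int (dim E)"
    by (intro aff_dim_zero hull_inc) (simp add: E_def)
  also have "dim E = CARD('n)"
    using dim_eq_full[of E] by (simp add: E_def span_insert_0)
  finally have "\<not> affine_dependent W"
    using W by (simp add: affine_independent_iff_card)
  moreover have "Q \<inter> int_lattice = W"
    using std_simplex_int_lattice affine_unimodular_int_lattice_iff[OF \<phi>(1)]
    unfolding \<phi>(2) W_def E_def by blast
  ultimately show ?thesis
    using that hull W by blast
qed

lemma aff_dim_hull_affine_independent:
  assumes "\<not> affine_dependent W" "V \<subseteq> W"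
  shows "aff_dim (convex hull V) = int (card V) - 1"
  using assms affine_independent_subset affine_independent_iff_card[of V] aff_dim_convex_hull by metis

text \<open>For a unimodular simplex \<open>Q\<close> the set \<open>W\<close> consists of its
  vertices, so the lattice points of \<open>P\<close>, moved back by \<open>t\<close>, select a face
  of \<open>Q\<close>.\<close>

lemma lattice_polytope_in_simplex:
  assumes "lattice_polytope P" "t \<in> int_lattice" "P \<subseteq> (+) t ` Q" "Q \<inter> int_lattice = W"
  obtains V where "V \<subseteq> W" "V \<noteq> {}" "lattice_translate P (convex hull V)"
proof -
  define V where "V = (\<lambda>x. - t + x) ` (P \<inter> int_lattice)"
  have "V \<subseteq> W"
    using assms int_lattice_diff[OF _ assms(2)] by (force simp: V_def)
  moreover have "V \<noteq> {}"
    using lattice_polytope_obtain_point[OF assms(1)] by (auto simp: V_def)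
  moreover have "P = (+) t ` (convex hull V)"
    using lattice_polytope_eq_hull[OF assms(1)]
    unfolding V_def convex_hull_translation image_image by simp
  ultimately show ?thesis
    using that assms(2) unfolding lattice_translate_def by blast
qed

context hollow_family
begin

text \<open>A member that is not a translate of \<open>Q\<close> is a translate of a face with
  proper nonempty vertex set \<open>V\<close>; by \<open>card_translates_le\<close> each such face
  accounts for at most \<open>card V - 1\<close> members.\<close>

lemma card_not_translates_le:
  assumes Q: "unimodular_simplex Q"
    and sub: "\<And>i. i < length Ps \<Longrightarrow> \<exists>Q'. lattice_translate Q' Q \<and> Ps ! i \<subseteq> Q'"
  shows "card {i. i < length Ps \<and> \<not> lattice_translate (Ps ! i) Q} \<le> (2 ^ CARD('n) - 1) * (CARD('n) - 1)"
proof -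
  obtain W where W: "Q = convex hull W" "finite W" "card W = Suc CARD('n)" "\<not> affine_dependent W"
    "Q \<inter> int_lattice = W"
    using unimodular_simplex_vertices[OF Q] .
  define I where "I = (\<lambda>V. {i. i < length Ps \<and> lattice_translate (Ps ! i) (convex hull V)})"
  have "{i. i < length Ps \<and> \<not> lattice_translate (Ps ! i) Q} \<subseteq> (\<Union>V\<in>Pow W - {{}, W}. I V)"
  proof
    fix i assume i: "i \<in> {i. i < length Ps \<and> \<not> lattice_translate (Ps ! i) Q}"
    then obtain t where "t \<in> int_lattice" "Ps ! i \<subseteq> (+) t ` Q"
      using sub unfolding lattice_translate_def by blast
    then obtain V where "V \<subseteq> W" "V \<noteq> {}" "lattice_translate (Ps ! i) (convex hull V)"
      using lattice_polytope_in_simplex[OF lattice_polytope _ _ W(5)] i by blast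
    then show "i \<in> (\<Union>V\<in>Pow W - {{}, W}. I V)"
      using i W(1) by (auto simp: I_def)
  qed
  moreover have "finite (\<Union>V\<in>Pow W - {{}, W}. I V)"
    using W(2) by (auto simp: I_def)
  ultimately have "card {i. i < length Ps \<and> \<not> lattice_translate (Ps ! i) Q} \<le> card (\<Union>V\<in>Pow W - {{}, W}. I V)"
    by (rule card_mono[rotated])
  also have "\<dots> \<le> (\<Sum>V\<in>Pow W - {{}, W}. card (I V))"
    using W(2) by (intro card_UN_le) auto
  also have "\<dots> \<le> (\<Sum>V\<in>Pow W - {{}, W}. card V - 1)"
  proof (rule sum_mono)
    fix V assume V: "V \<in> Pow W - {{}, W}"
    then have "card V < card W" "0 < card V"
      using W(2) psubset_card_mono[of W V] finite_subset[of V W] by (auto simp: card_gt_0_iff)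
    then show "card (I V) \<le> card V - 1"
      unfolding I_def using aff_dim_hull_affine_independent[OF W(4), of V] V W(3)
      by (intro card_translates_le) (auto simp: of_nat_diff)
  qed
  also have "\<dots> = (2 ^ CARD('n) - 1) * (CARD('n) - 1)"
    using sum_card_minus_one_proper_subsets[OF W(2,3)] by (simp add: Suc_leI)
  finally show ?thesis .
qed

text \<open>By \<open>card_translates_le\<close> so many translates force \<open>F\<close> to have
  full dimension. A basis of differences from \<open>v0\<close>, spread over distinct copies, is a
  full transversal and thus a lattice basis, as \<open>simplex_copies\<close> requires.\<close>

lemma many_translates_in_simplex:
  assumes G: "G \<subseteq> {..<length Ps}" "CARD('n) < card G" "\<And>i. i \<in> G \<Longrightarrow> lattice_translate (Ps ! i) F"
    and F: "lattice_polytope F"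
  obtains Q where "unimodular_simplex Q"
    "\<And>i. i < length Ps \<Longrightarrow> \<exists>Q'. lattice_translate Q' Q \<and> Ps ! i \<subseteq> Q'"
proof -
  obtain v0 where v0: "v0 \<in> F \<inter> int_lattice"
    using lattice_polytope_obtain_point[OF F] by blast
  obtain E where E: "E \<subseteq> (\<lambda>x. x - v0) ` (F \<inter> int_lattice)" "independent E" "lattice_diffs F \<subseteq> span E"
    "int (card E) = aff_dim F"
    using lattice_polytope_diff_basis[OF F v0] .
  have fin: "finite E" "card E \<le> CARD('n)" "finite G"
    using E(2) independent_bound[of E] G(1) finite_subset by auto
  have "card E = CARD('n)"
  proof (rule ccontr)
    assume "card E \<noteq> CARD('n)"
    then have "card {i. i < length Ps \<and> lattice_translate (Ps ! i) F} \<le> card E"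
      using E(4) fin(2) by (intro card_translates_le) auto
    moreover have "card G \<le> card {i. i < length Ps \<and> lattice_translate (Ps ! i) F}"
      using G by (intro card_mono) auto
    ultimately show False
      using G(2) fin(2) by simp
  qed
  then obtain \<beta> :: "'n \<Rightarrow> real ^ 'n" where \<beta>: "bij_betw \<beta> UNIV E"
    using finite_same_card_bij[of "UNIV :: 'n set" E] fin by auto
  have \<beta>E: "\<beta> i \<in> E" for i
    using \<beta> bij_betwE by blast
  have v: "v0 + \<beta> i \<in> F \<inter> int_lattice" for i
    using E(1) \<beta>E[of i] by auto
  obtain \<tau> :: "'n \<Rightarrow> nat" where \<tau>: "range \<tau> \<subseteq> G" "inj \<tau>"
    using card_le_inj[of "UNIV :: 'n set" G] G(2) fin by auto
  define f where "f = \<beta> \<circ> inv \<tau>"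
  have f_\<tau>: "f (\<tau> i) = \<beta> i" for i
    using \<tau>(2) by (simp add: f_def)
  have "bij_betw f (range \<tau>) E"
    unfolding f_def using \<tau>(2) \<beta> by (intro bij_betw_trans[OF _ \<beta>] bij_betw_inv_into inj_on_imp_bij_betw)
  then have "inj_on f (range \<tau>)" "independent (f ` range \<tau>)"
    using E(2) by (auto simp: bij_betw_def)
  moreover have "f (\<tau> i) \<in> D (\<tau> i)" for i
  proof -
    have "\<tau> i \<in> G"
      using \<tau>(1) by blast
    then have "D (\<tau> i) = lattice_diffs F"
      using G(3) lattice_translate_lattice_diffs by blast
    moreover have "(v0 + \<beta> i) - v0 \<in> lattice_diffs F"
      using v[of i] v0 unfolding lattice_diffs_def by blast
    ultimately show ?thesis
      using f_\<tau> by simp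
  qed
  ultimately have tr: "transversal f (range \<tau>)"
    using \<tau>(1) G(1) by (auto simp: transversal_def)
  have card: "card (range \<tau>) = CARD('n)"
    using \<tau>(2) by (simp add: card_image)
  obtain A B :: "real ^ 'n ^ 'n" where AB: "\<And>i j. A $ i $ j \<in> \<int>" "\<bar>det A\<bar> = 1"
    "\<And>i j. B $ i $ j \<in> \<int>" "\<bar>det B\<bar> = 1" "\<And>x. A *v (B *v x) = x" "\<And>x. B *v (A *v x) = x"
    "\<And>x. B *v x = (\<Sum>i\<in>UNIV. x $ i *\<^sub>R f (\<tau> i))"
    by (rule transversal_unimodular[OF tr card inj_on_imp_bij_betw[OF \<tau>(2)]]) (rule that; blast)
  interpret simplex_copies Ps G F v0 \<beta> A B
    using G v0 v AB by unfold_locales (auto simp: f_\<tau>)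
  define Q where "Q = (*v) B ` (convex hull (insert 0 Basis))"
  have "affine_unimodular ((*v) B)"
    unfolding affine_unimodular_def using AB(3,4) by (intro exI[of _ B] exI[of _ 0]) auto
  then have "unimodular_simplex Q"
    unfolding unimodular_simplex_def Q_def by blast
  moreover have "\<exists>Q'. lattice_translate Q' Q \<and> Ps ! i \<subseteq> Q'" if "i < length Ps" for i
    using member_in_simplex_translate[OF that] unfolding lattice_translate_def Q_def by blast
  ultimately show ?thesis
    using that by blast
qed

end

section \<open>From mixed degree zero to the classification\<close>

lemma mixed_degree_zero_hollow:
  fixes Ps :: "(real ^ 'n::finite) set list"
  assumes "\<forall>P\<in>set Ps. lattice_polytope P" "proper_family Ps" "mixed_degree Ps = 0" "CARD('n) < length Ps"
  shows "hollow_family Ps"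
proof
  fix I assume I: "I \<noteq> {}" "I \<subseteq> {..<length Ps}" "card I \<le> CARD('n)"
  define \<I> where "\<I> = {I. I \<noteq> {} \<and> I \<subseteq> {..<length Ps} \<and> int_points (subfamily_sum Ps I) \<noteq> {}}"
  have "mixed_codegree Ps = Suc CARD('n)"
    using assms(2,3) by (simp add: mixed_degree_def proper_family_def)
  then have "\<I> \<noteq> {} \<Longrightarrow> Min (card ` \<I>) = Suc CARD('n)"
    unfolding mixed_codegree_def \<I>_def[symmetric] Let_def by simp
  moreover have "finite \<I>"
    by (rule finite_subset[of _ "Pow {..<length Ps}"]) (auto simp: \<I>_def)
  ultimately have "I \<notin> \<I>"
    using I(3) Min_le[of "card ` \<I>" "card I"] by fastforce
  then show "int_points (subfamily_sum Ps I) = {}"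
    using I by (auto simp: \<I>_def)
qed (use assms(1) in auto)

theorem theorem2p5:
  "\<exists>\<E> :: (real ^ 'n::finite) set list set.
     finite \<E> \<and> (\<forall>Rs\<in>\<E>. \<forall>R\<in>set Rs. lattice_polytope R) \<and>
     (\<forall>Ps :: (real ^ 'n) set list.
        (\<forall>P\<in>set Ps. lattice_polytope P) \<and> proper_family Ps \<and>
        mixed_degree Ps = 0 \<and> length Ps > CARD('n)
        \<longrightarrow>
        ((\<exists>Q. unimodular_simplex Q \<and>
              (\<forall>i<length Ps. \<exists>Q'. lattice_translate Q' Q \<and> Ps ! i \<subseteq> Q'))
         \<or> (\<exists>Rs\<in>\<E>. identified Ps Rs))
        \<and>
        (\<forall>Q. unimodular_simplex Q \<and>
              (\<forall>i<length Ps. \<exists>Q'. lattice_translate Q' Q \<and> Ps ! i \<subseteq> Q')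
           \<longrightarrow>
           card {i. i < length Ps \<and> \<not> lattice_translate (Ps ! i) Q}
             \<le> (2 ^ CARD('n) - 1) * (CARD('n) - 1) \<and>
           (\<forall>F j. F face_of Q \<and> aff_dim F = int j \<and> j < CARD('n) \<longrightarrow>
              card {i. i < length Ps \<and> lattice_translate (Ps ! i) F} \<le> j)))"
proof -
  define \<P> where "\<P> = (box_polytopes (real CARD('n) ^ (CARD('n) + 2)) :: (real ^ 'n) set set)"
  \<comment> \<open>Families up to this length are exceptional. In a longer one, pigeonhole on
    \<open>\<P>\<close> gives more than \<open>CARD('n)\<close> translates of one member, which
    leads to the simplex case.\<close>
  define \<E> where "\<E> = {Rs. set Rs \<subseteq> \<P> \<and> length Rs \<le> CARD('n) * card \<P>}"
  have fin: "finite \<E>"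
    unfolding \<E>_def \<P>_def by (intro finite_lists_length_le finite_box_polytopes)
  have lattice: "\<forall>Rs\<in>\<E>. \<forall>R\<in>set Rs. lattice_polytope R"
    using box_polytopes_lattice_polytope by (auto simp: \<E>_def \<P>_def)
  have alternative: "(\<exists>Q. unimodular_simplex Q \<and> (\<forall>i<length Ps. \<exists>Q'. lattice_translate Q' Q \<and> Ps ! i \<subseteq> Q'))
      \<or> (\<exists>Rs\<in>\<E>. identified Ps Rs)"
    if hollow: "hollow_family Ps" and m: "CARD('n) < length Ps" for Ps :: "(real ^ 'n) set list"
  proof -
    interpret hollow_family Ps
      by (rule hollow)
    show ?thesis
    proof (cases "length Ps \<le> CARD('n) * card \<P>")
      case True
      obtain Rs where "identified Ps Rs" "length Rs = length Ps" "set Rs \<subseteq> \<P>"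
        using identified_with_box_family[OF m] unfolding \<P>_def by blast
      then show ?thesis
        using True by (auto simp: \<E>_def)
    next
      case False
      obtain G i0 where G: "G \<subseteq> {..<length Ps}" "CARD('n) < card G" "i0 < length Ps"
        "\<And>i. i \<in> G \<Longrightarrow> lattice_translate (Ps ! i) (Ps ! i0)"
        using many_translates[OF m] False by (auto simp: \<P>_def)
      show ?thesis
        using many_translates_in_simplex[OF G(1,2,4) lattice_polytope[OF G(3)]] by metis
    qed
  qed
  show ?thesis
  proof (intro exI[of _ \<E>] conjI allI impI fin lattice)
    fix Ps :: "(real ^ 'n) set list"
    assume Ps: "(\<forall>P\<in>set Ps. lattice_polytope P) \<and> proper_family Ps \<and> mixed_degree Ps = 0 \<and> CARD('n) < length Ps"
    then have "hollow_family Ps"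
      using mixed_degree_zero_hollow by blast
    then interpret hollow_family Ps .
    show "(\<exists>Q. unimodular_simplex Q \<and> (\<forall>i<length Ps. \<exists>Q'. lattice_translate Q' Q \<and> Ps ! i \<subseteq> Q'))
      \<or> (\<exists>Rs\<in>\<E>. identified Ps Rs)"
      using alternative[OF \<open>hollow_family Ps\<close>] Ps by blast
    fix Q assume "unimodular_simplex Q \<and> (\<forall>i<length Ps. \<exists>Q'. lattice_translate Q' Q \<and> Ps ! i \<subseteq> Q')"
    then show "card {i. i < length Ps \<and> \<not> lattice_translate (Ps ! i) Q} \<le> (2 ^ CARD('n) - 1) * (CARD('n) - 1)"
      using card_not_translates_le[of Q] by blast
    fix F j assume "F face_of Q \<and> aff_dim F = int j \<and> j < CARD('n)"
    then show "card {i. i < length Ps \<and> lattice_translate (Ps ! i) F} \<le> j"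
      using card_translates_le[of F j] by blast
  qed
qed

end
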